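(* Let $0\to K\to A\to Q\to0$ be an annihilator extension of finite skew braces. The transgression map $\mathrm{Tra}:\mathrm{Hom}(K,\mathbb{C}^\times)\to M_b(Q)$ is surjective if and only if the extension has the lifting property.
   Context: A skew brace is a triple $(A,+,\circ)$ where $(A,+)$ and $(A,\circ)$ are (not necessarily abelian) groups with $a\circ(b+c)=a\circ b-a+a\circ c$ for all $a,b,c\in A$. Both groups have the same neutral element $0$; $a'$ denotes the inverse of $a$ in $(A,\circ)$. An abelian group is regarded as a (trivial) skew brace with both operations equal to the group operation. The annihilator of a skew brace $A$ is $\mathrm{Ann}(A)=\{a\in A: -a+a\circ b=b\ \forall b\in A\}\cap Z(A,+)\cap Z(A,\circ)$. An annihilator extension of $Q$ by an abelian group $K$ is a short exact sequence of skew braces $0\to K\xrightarrow{\iota}A\xrightarrow{\pi}Q\to0$ with $\iota(K)\subseteq\mathrm{Ann}(A)$. For a skew brace $Q$ and a (multiplicative) abelian group $K$, a factor set is a pair $(\alpha,\mu)$ of maps $Q\times Q\to K$ such that for all $x,y,z\in Q$: $\alpha(0,y)=\alpha(x,0)=1$, $\mu(0,y)=\mu(x,0)=1$, $\alpha(y,z)\alpha(x+y,z)^{-1}\alpha(x,y+z)\alpha(x,y)^{-1}=1$, $\mu(y,z)\mu(x\circ y,z)^{-1}\mu(x,y\circ z)\mu(x,y)^{-1}=1$, and $\alpha(y,z)\mu(x,y+z)\alpha(-x,x)=\mu(x,z)\alpha(x\circ y,-x)\alpha(x\circ y-x,x\circ z)\mu(x,y)$. Factor sets form a group $Z^2_b(Q,K)$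 under pointwise multiplication. For $h:Q\to K$ put $\partial_+h(x,y)=h(y)h(x+y)^{-1}h(x)$ and $\partial_\circ h(x,y)=h(y)h(x\circ y)^{-1}h(x)$. Let $B^2_b(Q,K)=\{(\partial_+h,\partial_\circ h): h:Q\to K,\ h(0)=1\}$ and $H^2_b(Q,K)=Z^2_b(Q,K)/B^2_b(Q,K)$. The Schur multiplier of a finite skew brace $Q$ is $M_b(Q)=H^2_b(Q,\mathbb{C}^\times)$. Transgression: choose a map $t:Q\to A$ with $\pi t=\mathrm{id}_Q$, $t(0)=0$, and put $\alpha(x,y)=\iota^{-1}(t(x)+t(y)-t(x+y))$, $\mu(x,y)=\iota^{-1}(t(x)\circ t(y)\circ t(x\circ y)')$. Then $\mathrm{Tra}(\phi)$ is the class of $(\phi\alpha,\phi\mu)$ in $M_b(Q)$ (independent of $t$). A (complex degree-$n$) representation of a skew brace $A$ is a pair $(\beta,\rho)$ of group homomorphisms $\beta:(A,+)\to\mathrm{GL}_n(\mathbb{C})$, $\rho:(A,\circ)\to\mathrm{GL}_n(\mathbb{C})$ with $\beta(x\circ y)=\rho(x)\beta(y)\rho(x)^{-1}\beta(x)$ for all $x,y\in A$. For maps $\alpha_1,\mu_1:Q\times Q\to\mathbb{C}^\times$, a (degree-$n$) $(\alpha_1,\mu_1)$-representation of $Q$ is a pair of maps $\beta_1,\rho_1:Q\to\mathrm{GL}_n(\mathbb{C})$ with $\beta_1(0)=\rho_1(0)=\mathrm{id}$ and, for all $x,y\in Q$: $\beta_1(x)\beta_1(y)=\alpha_1(x,y)\beta_1(x+y)$,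 $\rho_1(x)\rho_1(y)=\mu_1(x,y)\rho_1(x\circ y)$, $\rho_1(x)\beta_1(y)\rho_1(x)^{-1}\beta_1(x)=\mu_1(x,y)\beta_1(x\circ y)$. It can be lifted to $A$ if there is a degree-$n$ representation $(\tilde\beta,\tilde\rho)$ of $A$ such that, for every $a\in A$, the classes of $\tilde\beta(a)$ and $\beta_1(\pi(a))$ in $\mathrm{PGL}_n(\mathbb{C})$ agree and the classes of $\tilde\rho(a)$ and $\rho_1(\pi(a))$ in $\mathrm{PGL}_n(\mathbb{C})$ agree. The annihilator extension has the lifting property if for all $n\geq1$ and all maps $\alpha_1,\mu_1:Q\times Q\to\mathbb{C}^\times$, every degree-$n$ $(\alpha_1,\mu_1)$-representation of $Q$ can be lifted to $A$. *)

theory Defs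
  imports "HOL-Algebra.Algebra" "Jordan_Normal_Form.Matrix"
begin

section \<open>Skew braces\<close>

text \<open>
  A skew brace lives on the record of rings: \<open>\<oplus>\<close>, \<open>\<zero>\<close>, \<open>\<ominus>\<close> are the (not necessarily
  commutative) additive group, and \<open>\<otimes>\<close>, \<open>\<one>\<close>, \<open>inv\<close> are the group \<open>(A, \<circ>)\<close>.  No ring axiom
  is assumed.  That \<open>\<one> = \<zero>\<close> follows from compatibility with \<open>b = c = \<zero>\<close>.
\<close>

locale skew_brace =
  fixes A (structure)
  assumes add_group: "group (add_monoid A)"
    and circ_group: "group A"
    and compat: "\<lbrakk>a \<in> carrier A; b \<in> carrier A; c \<in> carrier A\<rbrakk>
      \<Longrightarrow> a \<otimes> (b \<oplus> c) = ((a \<otimes> b) \<ominus> a) \<oplus> (a \<otimes> c)"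

definition trivial_brace :: "('k, 'm) monoid_scheme \<Rightarrow> 'k ring" where
  "trivial_brace K = \<lparr>carrier = carrier K, monoid.mult = monoid.mult K, one = one K,
     ring.zero = one K, add = monoid.mult K\<rparr>"

definition brace_hom :: "('a, 'm) ring_scheme \<Rightarrow> ('b, 'n) ring_scheme \<Rightarrow> ('a \<Rightarrow> 'b) set" where
  "brace_hom A B = hom (add_monoid A) (add_monoid B) \<inter> hom A B"

definition group_center :: "('a, 'm) monoid_scheme \<Rightarrow> 'a set" where
  "group_center G = {z \<in> carrier G. \<forall>g \<in> carrier G. z \<otimes>\<^bsub>G\<^esub> g = g \<otimes>\<^bsub>G\<^esub> z}"

definition Ann :: "('a, 'm) ring_scheme \<Rightarrow> 'a set" where
  "Ann A = {a \<in> carrier A. \<forall>b \<in> carrier A. (\<ominus>\<^bsub>A\<^esub> a) \<oplus>\<^bsub>A\<^esub> (a \<otimes>\<^bsub>A\<^esub> b) = b}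
     \<inter> group_center (add_monoid A) \<inter> group_center A"

locale annihilator_extension =
  fixes K :: "('k, 'l) monoid_scheme" and \<iota> :: "'k \<Rightarrow> 'a"
    and A :: "('a, 'm) ring_scheme" and \<pi> :: "'a \<Rightarrow> 'q"
    and Q :: "('q, 'n) ring_scheme"
  assumes K_abelian: "comm_group K"
    and A_brace: "skew_brace A"
    and Q_brace: "skew_brace Q"
    and \<iota>_hom: "\<iota> \<in> brace_hom (trivial_brace K) A"
    and \<pi>_hom: "\<pi> \<in> brace_hom A Q"
    and \<iota>_inj: "inj_on \<iota> (carrier K)"
    and exact: "\<iota> ` carrier K = {a \<in> carrier A. \<pi> a = \<zero>\<^bsub>Q\<^esub>}"
    and \<pi>_surj: "\<pi> ` carrier A = carrier Q"
    and annihilates: "\<iota> ` carrier K \<subseteq> Ann A"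


section \<open>Second cohomology and the Schur multiplier\<close>

text \<open>
  Maps \<open>Q \<times> Q \<rightarrow> K\<close> are taken extensional (\<open>undefined\<close> off \<open>Q \<times> Q\<close>), so that equality of
  cochains is equality on \<open>Q \<times> Q\<close> and the factor sets form a group.
\<close>

definition factor_set ::
  "('q, 'm) ring_scheme \<Rightarrow> ('k, 'n) monoid_scheme \<Rightarrow> ('q \<times> 'q \<Rightarrow> 'k) \<Rightarrow> ('q \<times> 'q \<Rightarrow> 'k) \<Rightarrow> bool"
where
  "factor_set Q K \<alpha> \<mu> \<longleftrightarrow>
     \<alpha> \<in> carrier Q \<times> carrier Q \<rightarrow>\<^sub>E carrier K \<and>
     \<mu> \<in> carrier Q \<times> carrier Q \<rightarrow>\<^sub>E carrier K \<and>
     (\<forall>x \<in> carrier Q. \<forall>y \<in> carrier Q. \<forall>z \<in> carrier Q.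
       \<alpha> (\<zero>\<^bsub>Q\<^esub>, y) = \<one>\<^bsub>K\<^esub> \<and> \<alpha> (x, \<zero>\<^bsub>Q\<^esub>) = \<one>\<^bsub>K\<^esub> \<and>
       \<mu> (\<zero>\<^bsub>Q\<^esub>, y) = \<one>\<^bsub>K\<^esub> \<and> \<mu> (x, \<zero>\<^bsub>Q\<^esub>) = \<one>\<^bsub>K\<^esub> \<and>
       \<alpha> (y, z) \<otimes>\<^bsub>K\<^esub> inv\<^bsub>K\<^esub> \<alpha> (x \<oplus>\<^bsub>Q\<^esub> y, z) \<otimes>\<^bsub>K\<^esub> \<alpha> (x, y \<oplus>\<^bsub>Q\<^esub> z) \<otimes>\<^bsub>K\<^esub> inv\<^bsub>K\<^esub> \<alpha> (x, y) = \<one>\<^bsub>K\<^esub> \<and>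
       \<mu> (y, z) \<otimes>\<^bsub>K\<^esub> inv\<^bsub>K\<^esub> \<mu> (x \<otimes>\<^bsub>Q\<^esub> y, z) \<otimes>\<^bsub>K\<^esub> \<mu> (x, y \<otimes>\<^bsub>Q\<^esub> z) \<otimes>\<^bsub>K\<^esub> inv\<^bsub>K\<^esub> \<mu> (x, y) = \<one>\<^bsub>K\<^esub> \<and>
       \<alpha> (y, z) \<otimes>\<^bsub>K\<^esub> \<mu> (x, y \<oplus>\<^bsub>Q\<^esub> z) \<otimes>\<^bsub>K\<^esub> \<alpha> (\<ominus>\<^bsub>Q\<^esub> x, x) =
         \<mu> (x, z) \<otimes>\<^bsub>K\<^esub> \<alpha> (x \<otimes>\<^bsub>Q\<^esub> y, \<ominus>\<^bsub>Q\<^esub> x)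
           \<otimes>\<^bsub>K\<^esub> \<alpha> ((x \<otimes>\<^bsub>Q\<^esub> y) \<ominus>\<^bsub>Q\<^esub> x, x \<otimes>\<^bsub>Q\<^esub> z) \<otimes>\<^bsub>K\<^esub> \<mu> (x, y))"

definition Z2b ::
  "('q, 'm) ring_scheme \<Rightarrow> ('k, 'n) monoid_scheme \<Rightarrow> (('q \<times> 'q \<Rightarrow> 'k) \<times> ('q \<times> 'q \<Rightarrow> 'k)) monoid"
where
  "Z2b Q K =
     \<lparr>carrier = {(\<alpha>, \<mu>). factor_set Q K \<alpha> \<mu>},
      monoid.mult = (\<lambda>(\<alpha>, \<mu>) (\<alpha>', \<mu>').
        (\<lambda>p \<in> carrier Q \<times> carrier Q. \<alpha> p \<otimes>\<^bsub>K\<^esub> \<alpha>' p,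
         \<lambda>p \<in> carrier Q \<times> carrier Q. \<mu> p \<otimes>\<^bsub>K\<^esub> \<mu>' p)),
      one = (\<lambda>p \<in> carrier Q \<times> carrier Q. \<one>\<^bsub>K\<^esub>, \<lambda>p \<in> carrier Q \<times> carrier Q. \<one>\<^bsub>K\<^esub>)\<rparr>"

definition coboundary_add ::
  "('q, 'm) ring_scheme \<Rightarrow> ('k, 'n) monoid_scheme \<Rightarrow> ('q \<Rightarrow> 'k) \<Rightarrow> 'q \<times> 'q \<Rightarrow> 'k" where
  "coboundary_add Q K h = (\<lambda>(x, y) \<in> carrier Q \<times> carrier Q.
     h y \<otimes>\<^bsub>K\<^esub> inv\<^bsub>K\<^esub> h (x \<oplus>\<^bsub>Q\<^esub> y) \<otimes>\<^bsub>K\<^esub> h x)"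

definition coboundary_circ ::
  "('q, 'm) ring_scheme \<Rightarrow> ('k, 'n) monoid_scheme \<Rightarrow> ('q \<Rightarrow> 'k) \<Rightarrow> 'q \<times> 'q \<Rightarrow> 'k" where
  "coboundary_circ Q K h = (\<lambda>(x, y) \<in> carrier Q \<times> carrier Q.
     h y \<otimes>\<^bsub>K\<^esub> inv\<^bsub>K\<^esub> h (x \<otimes>\<^bsub>Q\<^esub> y) \<otimes>\<^bsub>K\<^esub> h x)"

definition B2b ::
  "('q, 'm) ring_scheme \<Rightarrow> ('k, 'n) monoid_scheme \<Rightarrow> (('q \<times> 'q \<Rightarrow> 'k) \<times> ('q \<times> 'q \<Rightarrow> 'k)) set"
where
  "B2b Q K = {(coboundary_add Q K h, coboundary_circ Q K h) | h.
     h \<in> carrier Q \<rightarrow> carrier K \<and> h \<zero>\<^bsub>Q\<^esub> = \<one>\<^bsub>K\<^esub>}"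

definition H2b ::
  "('q, 'm) ring_scheme \<Rightarrow> ('k, 'n) monoid_scheme
     \<Rightarrow> (('q \<times> 'q \<Rightarrow> 'k) \<times> ('q \<times> 'q \<Rightarrow> 'k)) set monoid" where
  "H2b Q K = Z2b Q K Mod B2b Q K"

definition Cstar :: "complex monoid" where
  "Cstar = \<lparr>carrier = UNIV - {0}, monoid.mult = (*), one = 1\<rparr>"

definition schur_multiplier ::
  "('q, 'm) ring_scheme \<Rightarrow> (('q \<times> 'q \<Rightarrow> complex) \<times> ('q \<times> 'q \<Rightarrow> complex)) set monoid" where
  "schur_multiplier Q = H2b Q Cstar"


section \<open>Transgression\<close>

definition normalized_section ::
  "('a, 'm) ring_scheme \<Rightarrow> ('a \<Rightarrow> 'q) \<Rightarrow> ('q, 'n) ring_scheme \<Rightarrow> ('q \<Rightarrow> 'a) \<Rightarrow> bool" where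
  "normalized_section A \<pi> Q t \<longleftrightarrow>
     t \<in> carrier Q \<rightarrow> carrier A \<and> (\<forall>x \<in> carrier Q. \<pi> (t x) = x) \<and> t \<zero>\<^bsub>Q\<^esub> = \<zero>\<^bsub>A\<^esub>"

definition cocycle_add ::
  "('k, 'l) monoid_scheme \<Rightarrow> ('k \<Rightarrow> 'a) \<Rightarrow> ('a, 'm) ring_scheme \<Rightarrow> ('q, 'n) ring_scheme
     \<Rightarrow> ('q \<Rightarrow> 'a) \<Rightarrow> 'q \<times> 'q \<Rightarrow> 'k" where
  "cocycle_add K \<iota> A Q t = (\<lambda>(x, y).
     inv_into (carrier K) \<iota> ((t x \<oplus>\<^bsub>A\<^esub> t y) \<ominus>\<^bsub>A\<^esub> t (x \<oplus>\<^bsub>Q\<^esub> y)))"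

definition cocycle_circ ::
  "('k, 'l) monoid_scheme \<Rightarrow> ('k \<Rightarrow> 'a) \<Rightarrow> ('a, 'm) ring_scheme \<Rightarrow> ('q, 'n) ring_scheme
     \<Rightarrow> ('q \<Rightarrow> 'a) \<Rightarrow> 'q \<times> 'q \<Rightarrow> 'k" where
  "cocycle_circ K \<iota> A Q t = (\<lambda>(x, y).
     inv_into (carrier K) \<iota> ((t x \<otimes>\<^bsub>A\<^esub> t y) \<otimes>\<^bsub>A\<^esub> inv\<^bsub>A\<^esub> t (x \<otimes>\<^bsub>Q\<^esub> y)))"

definition transgression_via ::
  "('k, 'l) monoid_scheme \<Rightarrow> ('k \<Rightarrow> 'a) \<Rightarrow> ('a, 'm) ring_scheme \<Rightarrow> ('q, 'n) ring_scheme
     \<Rightarrow> ('q \<Rightarrow> 'a) \<Rightarrow> ('k \<Rightarrow> complex)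
     \<Rightarrow> (('q \<times> 'q \<Rightarrow> complex) \<times> ('q \<times> 'q \<Rightarrow> complex)) set" where
  "transgression_via K \<iota> A Q t \<phi> =
     B2b Q Cstar #>\<^bsub>Z2b Q Cstar\<^esub>
       (\<lambda>p \<in> carrier Q \<times> carrier Q. \<phi> (cocycle_add K \<iota> A Q t p),
        \<lambda>p \<in> carrier Q \<times> carrier Q. \<phi> (cocycle_circ K \<iota> A Q t p))"

text \<open>The class does not depend on the section, so an arbitrary one is chosen.\<close>

definition Tra ::
  "('k, 'l) monoid_scheme \<Rightarrow> ('k \<Rightarrow> 'a) \<Rightarrow> ('a, 'm) ring_scheme \<Rightarrow> ('a \<Rightarrow> 'q)
     \<Rightarrow> ('q, 'n) ring_scheme \<Rightarrow> ('k \<Rightarrow> complex)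
     \<Rightarrow> (('q \<times> 'q \<Rightarrow> complex) \<times> ('q \<times> 'q \<Rightarrow> complex)) set" where
  "Tra K \<iota> A \<pi> Q = transgression_via K \<iota> A Q (SOME t. normalized_section A \<pi> Q t)"

lemma (in annihilator_extension) normalized_section_exists:
  "\<exists>t. normalized_section A \<pi> Q t"
proof -
  interpret A: group "add_monoid A" using A_brace by (rule skew_brace.add_group)
  interpret Q: group "add_monoid Q" using Q_brace by (rule skew_brace.add_group)
  have \<pi>0: "\<pi> \<zero>\<^bsub>A\<^esub> = \<zero>\<^bsub>Q\<^esub>"
    using hom_one[OF _ A.is_group Q.is_group] \<pi>_hom unfolding brace_hom_def by simp
  let ?t = "(inv_into (carrier A) \<pi>)(\<zero>\<^bsub>Q\<^esub> := \<zero>\<^bsub>A\<^esub>)"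
  have "normalized_section A \<pi> Q ?t"
    using \<pi>0 \<pi>_surj A.one_closed
    by (auto simp: normalized_section_def f_inv_into_f intro!: inv_into_into)
  then show ?thesis by blast
qed


section \<open>Representations and lifting\<close>

definition GL :: "nat \<Rightarrow> complex mat monoid" where
  "GL n = units_of (ring_mat TYPE(complex) n ())"

definition nonzero_scalars :: "nat \<Rightarrow> complex mat set" where
  "nonzero_scalars n = {c \<cdot>\<^sub>m 1\<^sub>m n | c. c \<noteq> 0}"

definition PGL :: "nat \<Rightarrow> complex mat set monoid" where
  "PGL n = GL n Mod nonzero_scalars n"

definition PGL_class :: "nat \<Rightarrow> complex mat \<Rightarrow> complex mat set" where
  "PGL_class n M = nonzero_scalars n #>\<^bsub>GL n\<^esub> M"

lemma PGL_class_in_PGL: "M \<in> carrier (GL n) \<Longrightarrow> PGL_class n M \<in> carrier (PGL n)"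
  by (auto simp: PGL_def PGL_class_def FactGroup_def RCOSETS_def)

definition brace_representation ::
  "nat \<Rightarrow> ('a, 'm) ring_scheme \<Rightarrow> ('a \<Rightarrow> complex mat) \<Rightarrow> ('a \<Rightarrow> complex mat) \<Rightarrow> bool" where
  "brace_representation n A \<beta> \<rho> \<longleftrightarrow>
     \<beta> \<in> hom (add_monoid A) (GL n) \<and> \<rho> \<in> hom A (GL n) \<and>
     (\<forall>x \<in> carrier A. \<forall>y \<in> carrier A.
        \<beta> (x \<otimes>\<^bsub>A\<^esub> y) = \<rho> x \<otimes>\<^bsub>GL n\<^esub> \<beta> y \<otimes>\<^bsub>GL n\<^esub> inv\<^bsub>GL n\<^esub> (\<rho> x) \<otimes>\<^bsub>GL n\<^esub> \<beta> x)"

definition projective_brace_representation ::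
  "nat \<Rightarrow> ('q, 'm) ring_scheme \<Rightarrow> ('q \<times> 'q \<Rightarrow> complex) \<Rightarrow> ('q \<times> 'q \<Rightarrow> complex)
     \<Rightarrow> ('q \<Rightarrow> complex mat) \<Rightarrow> ('q \<Rightarrow> complex mat) \<Rightarrow> bool" where
  "projective_brace_representation n Q \<alpha>\<^sub>1 \<mu>\<^sub>1 \<beta>\<^sub>1 \<rho>\<^sub>1 \<longleftrightarrow>
     \<beta>\<^sub>1 \<in> carrier Q \<rightarrow> carrier (GL n) \<and> \<rho>\<^sub>1 \<in> carrier Q \<rightarrow> carrier (GL n) \<and>
     \<beta>\<^sub>1 \<zero>\<^bsub>Q\<^esub> = \<one>\<^bsub>GL n\<^esub> \<and> \<rho>\<^sub>1 \<zero>\<^bsub>Q\<^esub> = \<one>\<^bsub>GL n\<^esub> \<and>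
     (\<forall>x \<in> carrier Q. \<forall>y \<in> carrier Q.
        \<beta>\<^sub>1 x \<otimes>\<^bsub>GL n\<^esub> \<beta>\<^sub>1 y = \<alpha>\<^sub>1 (x, y) \<cdot>\<^sub>m \<beta>\<^sub>1 (x \<oplus>\<^bsub>Q\<^esub> y) \<and>
        \<rho>\<^sub>1 x \<otimes>\<^bsub>GL n\<^esub> \<rho>\<^sub>1 y = \<mu>\<^sub>1 (x, y) \<cdot>\<^sub>m \<rho>\<^sub>1 (x \<otimes>\<^bsub>Q\<^esub> y) \<and>
        \<rho>\<^sub>1 x \<otimes>\<^bsub>GL n\<^esub> \<beta>\<^sub>1 y \<otimes>\<^bsub>GL n\<^esub> inv\<^bsub>GL n\<^esub> (\<rho>\<^sub>1 x) \<otimes>\<^bsub>GL n\<^esub> \<beta>\<^sub>1 x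
          = \<mu>\<^sub>1 (x, y) \<cdot>\<^sub>m \<beta>\<^sub>1 (x \<otimes>\<^bsub>Q\<^esub> y))"

definition can_be_lifted ::
  "nat \<Rightarrow> ('a, 'm) ring_scheme \<Rightarrow> ('a \<Rightarrow> 'q)
     \<Rightarrow> ('q \<Rightarrow> complex mat) \<Rightarrow> ('q \<Rightarrow> complex mat) \<Rightarrow> bool" where
  "can_be_lifted n A \<pi> \<beta>\<^sub>1 \<rho>\<^sub>1 \<longleftrightarrow>
     (\<exists>\<beta> \<rho>. brace_representation n A \<beta> \<rho> \<and>
       (\<forall>a \<in> carrier A. PGL_class n (\<beta> a) = PGL_class n (\<beta>\<^sub>1 (\<pi> a)) \<and>
                          PGL_class n (\<rho> a) = PGL_class n (\<rho>\<^sub>1 (\<pi> a))))"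

definition lifting_property ::
  "('a, 'm) ring_scheme \<Rightarrow> ('a \<Rightarrow> 'q) \<Rightarrow> ('q, 'n) ring_scheme \<Rightarrow> bool" where
  "lifting_property A \<pi> Q \<longleftrightarrow>
     (\<forall>n \<ge> 1. \<forall>\<alpha>\<^sub>1 \<mu>\<^sub>1 \<beta>\<^sub>1 \<rho>\<^sub>1.
        \<alpha>\<^sub>1 \<in> carrier Q \<times> carrier Q \<rightarrow> carrier Cstar \<longrightarrow>
        \<mu>\<^sub>1 \<in> carrier Q \<times> carrier Q \<rightarrow> carrier Cstar \<longrightarrow>
        projective_brace_representation n Q \<alpha>\<^sub>1 \<mu>\<^sub>1 \<beta>\<^sub>1 \<rho>\<^sub>1 \<longrightarrow>
        can_be_lifted n A \<pi> \<beta>\<^sub>1 \<rho>\<^sub>1)"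

end

theory Submission
  imports Defs
begin

text \<open>
  A projective representation of \<open>Q\<close> forces its multipliers to be a factor set.  If that factor
  set is \<open>(\<phi>\<alpha>, \<phi>\<mu>)\<close> up to the coboundary of \<open>h\<close>, then \<open>\<iota> k + t x \<mapsto> \<phi> k (h x)\<inverse> \<beta>\<^sub>1 x\<close> (and
  likewise with \<open>\<rho>\<^sub>1\<close>) is a lift.  Conversely, every factor set \<open>(\<alpha>, \<mu>)\<close> is realised by the twisted
  regular representation \<open>\<beta>\<^sub>1 x e\<^sub>z = \<alpha> (x, z) e\<^bsub>x + z\<^esub>\<close>, \<open>\<rho>\<^sub>1 x e\<^sub>z = \<mu> (x, z) e\<^bsub>x \<circ> z\<^esub>\<close>.  A lift
  \<open>(\<beta>, \<rho>)\<close> of it has \<open>\<beta> a = c a \<beta>\<^sub>1 (\<pi> a)\<close> for scalars \<open>c a\<close>; then \<open>\<phi> = c \<circ> \<iota>\<close> is a character with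
  \<open>Tra \<phi> = [(\<alpha>, \<mu>)]\<close>, the cobounding map being \<open>x \<mapsto> (c (t x))\<inverse>\<close>.  The scalars of \<open>\<rho>\<close>, which may
  differ from those of \<open>\<beta>\<close> on \<open>K\<close>, play no role: they cancel in the compatibility
  relation, which already determines \<open>\<mu>\<close>.
\<close>

section \<open>Skew braces and annihilator extensions\<close>

text \<open>The rewrites let the laws of the additive group fire directly on
  \<open>\<oplus>\<close>, \<open>\<zero>\<close> and \<open>\<ominus>\<close>.\<close>

sublocale skew_brace \<subseteq> add: group "add_monoid A"
  rewrites "carrier (add_monoid A) = carrier A"
    and "monoid.mult (add_monoid A) = (\<oplus>)"
    and "\<one>\<^bsub>add_monoid A\<^esub> = \<zero>"
    and "m_inv (add_monoid A) = a_inv A"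
  by (rule add_group) (auto simp: a_inv_def)

sublocale skew_brace \<subseteq> circ: group A
  by (rule circ_group)

context skew_brace
begin

text \<open>Compatibility with a = 1 and b = c = 0 collapses to 0 = -1, and inversion fixes
  0.\<close>

lemma one_eq_zero: "\<one> = \<zero>"
proof -
  have "\<one> \<otimes> (\<zero> \<oplus> \<zero>) = ((\<one> \<otimes> \<zero>) \<ominus> \<one>) \<oplus> (\<one> \<otimes> \<zero>)"
    by (rule compat) auto
  then have "\<zero> = \<ominus> \<one>" by (simp add: a_minus_def)
  then show ?thesis by (metis add.inv_inv add.inv_one circ.one_closed)
qed

lemma minus_closed [simp, intro]: "\<lbrakk>a \<in> carrier A; b \<in> carrier A\<rbrakk> \<Longrightarrow> a \<ominus> b \<in> carrier A"
  by (simp add: a_minus_def)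

text \<open>The clause -k + k \<circ> a = a in \<open>Ann\<close> gives this after adding k on the
  left. It lets both groups of A share one coordinate system over K and Q.\<close>

lemma Ann_circ_eq_add:
  assumes "k \<in> Ann A" "a \<in> carrier A"
  shows "k \<otimes> a = k \<oplus> a"
proof -
  have k: "k \<in> carrier A" "\<ominus> k \<oplus> (k \<otimes> a) = a" using assms by (auto simp: Ann_def)
  then have "k \<oplus> (\<ominus> k \<oplus> (k \<otimes> a)) = k \<oplus> a" by simp
  then show ?thesis using k(1) assms(2) by (simp flip: add.m_assoc)
qed

lemma Ann_add_comm: "\<lbrakk>k \<in> Ann A; a \<in> carrier A\<rbrakk> \<Longrightarrow> a \<oplus> k = k \<oplus> a"
  by (simp add: Ann_def group_center_def)

lemma Ann_circ_comm: "\<lbrakk>k \<in> Ann A; a \<in> carrier A\<rbrakk> \<Longrightarrow> a \<otimes> k = k \<otimes> a"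
  by (simp add: Ann_def group_center_def)

end

section \<open>Coordinates on an annihilator extension relative to a section\<close>

locale annihilator_extension_section = annihilator_extension +
  fixes t
  assumes sec: "normalized_section A \<pi> Q t"
begin

sublocale K: comm_group K by (rule K_abelian)
sublocale A: skew_brace A by (rule A_brace)
sublocale Q: skew_brace Q by (rule Q_brace)

lemma t_closed [simp]: "x \<in> carrier Q \<Longrightarrow> t x \<in> carrier A"
  and \<pi>_t [simp]: "x \<in> carrier Q \<Longrightarrow> \<pi> (t x) = x"
  and t_zero [simp]: "t \<zero>\<^bsub>Q\<^esub> = \<zero>\<^bsub>A\<^esub>"
  using sec by (auto simp: normalized_section_def)

lemma \<pi>_closed [simp]: "a \<in> carrier A \<Longrightarrow> \<pi> a \<in> carrier Q"
  and \<pi>_add: "\<lbrakk>a \<in> carrier A; b \<in> carrier A\<rbrakk> \<Longrightarrow> \<pi> (a \<oplus>\<^bsub>A\<^esub> b) = \<pi> a \<oplus>\<^bsub>Q\<^esub> \<pi> b"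
  and \<pi>_circ: "\<lbrakk>a \<in> carrier A; b \<in> carrier A\<rbrakk> \<Longrightarrow> \<pi> (a \<otimes>\<^bsub>A\<^esub> b) = \<pi> a \<otimes>\<^bsub>Q\<^esub> \<pi> b"
  using \<pi>_hom by (auto simp: brace_hom_def hom_def)

lemma \<iota>_closed [simp]: "k \<in> carrier K \<Longrightarrow> \<iota> k \<in> carrier A"
  and \<iota>_mult: "\<lbrakk>k \<in> carrier K; l \<in> carrier K\<rbrakk> \<Longrightarrow> \<iota> (k \<otimes>\<^bsub>K\<^esub> l) = \<iota> k \<oplus>\<^bsub>A\<^esub> \<iota> l"
  using \<iota>_hom by (auto simp: brace_hom_def hom_def trivial_brace_def)

lemma \<iota>_Ann: "k \<in> carrier K \<Longrightarrow> \<iota> k \<in> Ann A"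
  using annihilates by auto

lemma \<pi>_\<iota> [simp]: "k \<in> carrier K \<Longrightarrow> \<pi> (\<iota> k) = \<zero>\<^bsub>Q\<^esub>"
  using exact by auto

lemma \<iota>_one [simp]: "\<iota> \<one>\<^bsub>K\<^esub> = \<zero>\<^bsub>A\<^esub>"
  using \<iota>_mult[of "\<one>\<^bsub>K\<^esub>" "\<one>\<^bsub>K\<^esub>"] by (metis A.add.l_cancel_one K.one_closed K.r_one \<iota>_closed)

text \<open>Once t is fixed, the pairs (k, x) are coordinates on A: x is read off by \<pi>, and k is
  then determined because \<iota> is injective.\<close>

definition elt where "elt k x = \<iota> k \<oplus>\<^bsub>A\<^esub> t x"

lemma elt_closed [simp]: "\<lbrakk>k \<in> carrier K; x \<in> carrier Q\<rbrakk> \<Longrightarrow> elt k x \<in> carrier A"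
  by (simp add: elt_def)

lemma \<pi>_elt [simp]: "\<lbrakk>k \<in> carrier K; x \<in> carrier Q\<rbrakk> \<Longrightarrow> \<pi> (elt k x) = x"
  by (simp add: elt_def \<pi>_add)

lemma elt_circ: "\<lbrakk>k \<in> carrier K; x \<in> carrier Q\<rbrakk> \<Longrightarrow> elt k x = \<iota> k \<otimes>\<^bsub>A\<^esub> t x"
  by (simp add: elt_def A.Ann_circ_eq_add \<iota>_Ann)

lemma elt_inject:
  assumes "k \<in> carrier K" "l \<in> carrier K" "x \<in> carrier Q"
  shows "elt k x = elt l x \<longleftrightarrow> k = l"
  using assms \<iota>_inj by (auto simp: elt_def inj_on_def)

lemma elt_one [simp]: "x \<in> carrier Q \<Longrightarrow> elt \<one>\<^bsub>K\<^esub> x = t x"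
  by (simp add: elt_def)

lemma elt_zero [simp]: "k \<in> carrier K \<Longrightarrow> elt k \<zero>\<^bsub>Q\<^esub> = \<iota> k"
  by (simp add: elt_def)

abbreviation "\<alpha>t \<equiv> cocycle_add K \<iota> A Q t"
abbreviation "\<mu>t \<equiv> cocycle_circ K \<iota> A Q t"

lemma ker_in_image: "\<lbrakk>a \<in> carrier A; \<pi> a = \<zero>\<^bsub>Q\<^esub>\<rbrakk> \<Longrightarrow> a \<in> \<iota> ` carrier K"
  using exact by auto

lemma \<pi>_minus:
  assumes "a \<in> carrier A" "b \<in> carrier A" "\<pi> a = \<pi> b"
  shows "\<pi> (a \<ominus>\<^bsub>A\<^esub> b) = \<zero>\<^bsub>Q\<^esub>"
proof -
  have "\<pi> (a \<ominus>\<^bsub>A\<^esub> b) \<oplus>\<^bsub>Q\<^esub> \<pi> b = \<pi> ((a \<ominus>\<^bsub>A\<^esub> b) \<oplus>\<^bsub>A\<^esub> b)" using assms by (simp add: \<pi>_add)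
  also have "(a \<ominus>\<^bsub>A\<^esub> b) \<oplus>\<^bsub>A\<^esub> b = a" using assms by (simp add: a_minus_def A.add.m_assoc)
  finally show ?thesis using assms by (metis A.minus_closed Q.add.r_cancel_one \<pi>_closed)
qed

lemma \<pi>_div:
  assumes "a \<in> carrier A" "b \<in> carrier A" "\<pi> a = \<pi> b"
  shows "\<pi> (a \<otimes>\<^bsub>A\<^esub> inv\<^bsub>A\<^esub> b) = \<zero>\<^bsub>Q\<^esub>"
proof -
  have "\<pi> (a \<otimes>\<^bsub>A\<^esub> inv\<^bsub>A\<^esub> b) \<otimes>\<^bsub>Q\<^esub> \<pi> b = \<pi> ((a \<otimes>\<^bsub>A\<^esub> inv\<^bsub>A\<^esub> b) \<otimes>\<^bsub>A\<^esub> b)" using assms by (simp add: \<pi>_circ)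
  also have "(a \<otimes>\<^bsub>A\<^esub> inv\<^bsub>A\<^esub> b) \<otimes>\<^bsub>A\<^esub> b = a" using assms by (simp add: A.circ.m_assoc)
  finally show ?thesis using assms Q.one_eq_zero
    by (metis A.circ.inv_closed A.circ.m_closed Q.circ.r_cancel_one \<pi>_closed)
qed

lemma add_defect_in_image:
  "\<lbrakk>x \<in> carrier Q; y \<in> carrier Q\<rbrakk> \<Longrightarrow> (t x \<oplus>\<^bsub>A\<^esub> t y) \<ominus>\<^bsub>A\<^esub> t (x \<oplus>\<^bsub>Q\<^esub> y) \<in> \<iota> ` carrier K"
  by (intro ker_in_image \<pi>_minus) (auto simp: \<pi>_add)

lemma circ_defect_in_image:
  "\<lbrakk>x \<in> carrier Q; y \<in> carrier Q\<rbrakk> \<Longrightarrow> (t x \<otimes>\<^bsub>A\<^esub> t y) \<otimes>\<^bsub>A\<^esub> inv\<^bsub>A\<^esub> t (x \<otimes>\<^bsub>Q\<^esub> y) \<in> \<iota> ` carrier K"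
  by (intro ker_in_image \<pi>_div) (auto simp: \<pi>_circ)

lemma \<alpha>t_closed [simp]: "\<lbrakk>x \<in> carrier Q; y \<in> carrier Q\<rbrakk> \<Longrightarrow> \<alpha>t (x, y) \<in> carrier K"
  by (simp add: cocycle_add_def inv_into_into add_defect_in_image)

lemma \<mu>t_closed [simp]: "\<lbrakk>x \<in> carrier Q; y \<in> carrier Q\<rbrakk> \<Longrightarrow> \<mu>t (x, y) \<in> carrier K"
  by (simp add: cocycle_circ_def inv_into_into circ_defect_in_image)

text \<open>The defect of t lies in the image of \<iota>, so \<iota> undoes the
  \<open>inv_into\<close> in \<open>cocycle_add\<close>; the cocycle is the K-coordinate of t x + t
  y.\<close>

lemma t_add:
  assumes "x \<in> carrier Q" "y \<in> carrier Q"
  shows "t x \<oplus>\<^bsub>A\<^esub> t y = elt (\<alpha>t (x, y)) (x \<oplus>\<^bsub>Q\<^esub> y)"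
proof -
  have "\<iota> (\<alpha>t (x, y)) = (t x \<oplus>\<^bsub>A\<^esub> t y) \<ominus>\<^bsub>A\<^esub> t (x \<oplus>\<^bsub>Q\<^esub> y)"
    using assms by (simp add: cocycle_add_def f_inv_into_f add_defect_in_image)
  then show ?thesis using assms by (simp add: elt_def a_minus_def A.add.m_assoc)
qed

lemma t_circ:
  assumes "x \<in> carrier Q" "y \<in> carrier Q"
  shows "t x \<otimes>\<^bsub>A\<^esub> t y = elt (\<mu>t (x, y)) (x \<otimes>\<^bsub>Q\<^esub> y)"
proof -
  have "\<iota> (\<mu>t (x, y)) = (t x \<otimes>\<^bsub>A\<^esub> t y) \<otimes>\<^bsub>A\<^esub> inv\<^bsub>A\<^esub> t (x \<otimes>\<^bsub>Q\<^esub> y)"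
    using assms by (simp add: cocycle_circ_def f_inv_into_f circ_defect_in_image)
  then show ?thesis using assms by (simp add: elt_circ A.circ.m_assoc)
qed

text \<open>Subtracting t (\<pi> a) from a leaves an element of the kernel of \<pi>, which is the
  image of \<iota> by exactness.\<close>

lemma elt_cases:
  assumes "a \<in> carrier A"
  obtains k x where "k \<in> carrier K" "x \<in> carrier Q" "a = elt k x"
proof -
  have "a \<ominus>\<^bsub>A\<^esub> t (\<pi> a) \<in> \<iota> ` carrier K"
    using assms by (intro ker_in_image \<pi>_minus) auto
  then obtain k where k: "k \<in> carrier K" "\<iota> k = a \<ominus>\<^bsub>A\<^esub> t (\<pi> a)" by auto
  then have "a = elt k (\<pi> a)" using assms by (simp add: elt_def a_minus_def A.add.m_assoc)
  then show thesis using that[OF k(1) \<pi>_closed[OF assms]] by simp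
qed

lemma \<iota>_add_elt:
  "\<lbrakk>k \<in> carrier K; l \<in> carrier K; x \<in> carrier Q\<rbrakk> \<Longrightarrow> \<iota> k \<oplus>\<^bsub>A\<^esub> elt l x = elt (k \<otimes>\<^bsub>K\<^esub> l) x"
  by (simp add: elt_def \<iota>_mult A.add.m_assoc)

text \<open>Since \<iota> l is central in (A, +), it moves to the left past t x; the remaining t x +
  t y contributes the cocycle. In coordinates, addition is that of K times Q twisted by
  \<open>\<alpha>t\<close>.\<close>

lemma elt_add:
  assumes [simp]: "k \<in> carrier K" "l \<in> carrier K" "x \<in> carrier Q" "y \<in> carrier Q"
  shows "elt k x \<oplus>\<^bsub>A\<^esub> elt l y = elt (k \<otimes>\<^bsub>K\<^esub> l \<otimes>\<^bsub>K\<^esub> \<alpha>t (x, y)) (x \<oplus>\<^bsub>Q\<^esub> y)"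
proof -
  have "elt k x \<oplus>\<^bsub>A\<^esub> elt l y = \<iota> k \<oplus>\<^bsub>A\<^esub> (t x \<oplus>\<^bsub>A\<^esub> \<iota> l) \<oplus>\<^bsub>A\<^esub> t y"
    by (simp add: elt_def A.add.m_assoc)
  also have "\<dots> = \<iota> k \<oplus>\<^bsub>A\<^esub> (\<iota> l \<oplus>\<^bsub>A\<^esub> (t x \<oplus>\<^bsub>A\<^esub> t y))"
    by (simp add: A.Ann_add_comm \<iota>_Ann A.add.m_assoc)
  finally show ?thesis by (simp add: t_add \<iota>_add_elt K.m_assoc)
qed

text \<open>The same computation through \<open>elt_circ\<close>, as \<iota> l is also central in
  (A, \<circ>). The K-coordinates again multiply in K because \<iota> k \<circ> a = \<iota> k +
  a.\<close>

lemma elt_mult: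
  assumes [simp]: "k \<in> carrier K" "l \<in> carrier K" "x \<in> carrier Q" "y \<in> carrier Q"
  shows "elt k x \<otimes>\<^bsub>A\<^esub> elt l y = elt (k \<otimes>\<^bsub>K\<^esub> l \<otimes>\<^bsub>K\<^esub> \<mu>t (x, y)) (x \<otimes>\<^bsub>Q\<^esub> y)"
proof -
  have "elt k x \<otimes>\<^bsub>A\<^esub> elt l y = \<iota> k \<otimes>\<^bsub>A\<^esub> (t x \<otimes>\<^bsub>A\<^esub> \<iota> l) \<otimes>\<^bsub>A\<^esub> t y"
    by (simp add: elt_circ A.circ.m_assoc)
  also have "\<dots> = \<iota> k \<otimes>\<^bsub>A\<^esub> (\<iota> l \<otimes>\<^bsub>A\<^esub> (t x \<otimes>\<^bsub>A\<^esub> t y))"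
    by (simp add: A.Ann_circ_comm \<iota>_Ann A.circ.m_assoc)
  finally show ?thesis by (simp add: t_circ \<iota>_add_elt K.m_assoc A.Ann_circ_eq_add \<iota>_Ann)
qed

end


section \<open>Factor sets with values in the nonzero complex numbers\<close>

lemma carrier_Cstar [simp]: "x \<in> carrier Cstar \<longleftrightarrow> x \<noteq> 0"
  and mult_Cstar [simp]: "x \<otimes>\<^bsub>Cstar\<^esub> y = x * y"
  and one_Cstar [simp]: "\<one>\<^bsub>Cstar\<^esub> = 1"
  by (simp_all add: Cstar_def)

lemma comm_group_Cstar: "comm_group Cstar"
proof (rule comm_groupI)
  show "\<exists>y\<in>carrier Cstar. y \<otimes>\<^bsub>Cstar\<^esub> x = \<one>\<^bsub>Cstar\<^esub>" if "x \<in> carrier Cstar" for x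
    using that by (intro bexI[of _ "inverse x"]) auto
qed auto

lemma group_Cstar: "group Cstar"
  using comm_group_Cstar by (rule comm_group.axioms(2))

lemma inv_Cstar [simp]: "x \<noteq> 0 \<Longrightarrow> inv\<^bsub>Cstar\<^esub> x = inverse x"
  by (intro group.inv_equality[OF group_Cstar]) auto

text \<open>The conditions on a factor set with inverses cleared. The maps are arbitrary off the
  carrier; the restrictions in the conclusion meet the extensionality in
  \<open>factor_set\<close>.\<close>

lemma (in skew_brace) factor_set_CstarI:
  assumes "\<And>x y. \<lbrakk>x \<in> carrier A; y \<in> carrier A\<rbrakk> \<Longrightarrow> \<alpha> (x, y) \<noteq> 0 \<and> \<mu> (x, y) \<noteq> 0"
    and "\<And>x. x \<in> carrier A \<Longrightarrow> \<alpha> (\<zero>, x) = 1 \<and> \<alpha> (x, \<zero>) = 1 \<and> \<mu> (\<zero>, x) = 1 \<and> \<mu> (x, \<zero>) = 1"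
    and "\<And>x y z. \<lbrakk>x \<in> carrier A; y \<in> carrier A; z \<in> carrier A\<rbrakk>
      \<Longrightarrow> \<alpha> (y, z) * \<alpha> (x, y \<oplus> z) = \<alpha> (x, y) * \<alpha> (x \<oplus> y, z)"
    and "\<And>x y z. \<lbrakk>x \<in> carrier A; y \<in> carrier A; z \<in> carrier A\<rbrakk>
      \<Longrightarrow> \<mu> (y, z) * \<mu> (x, y \<otimes> z) = \<mu> (x, y) * \<mu> (x \<otimes> y, z)"
    and "\<And>x y z. \<lbrakk>x \<in> carrier A; y \<in> carrier A; z \<in> carrier A\<rbrakk>
      \<Longrightarrow> \<alpha> (y, z) * \<mu> (x, y \<oplus> z) * \<alpha> (\<ominus> x, x)
        = \<mu> (x, z) * \<alpha> (x \<otimes> y, \<ominus> x) * \<alpha> ((x \<otimes> y) \<ominus> x, x \<otimes> z) * \<mu> (x, y)"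
  shows "factor_set A Cstar (restrict \<alpha> (carrier A \<times> carrier A)) (restrict \<mu> (carrier A \<times> carrier A))"
  unfolding factor_set_def
proof (intro conjI ballI)
  fix x y z assume [simp]: "x \<in> carrier A" "y \<in> carrier A" "z \<in> carrier A"
  note nz = assms(1)
  have [simp]: "\<alpha> (u, v) \<noteq> 0" "\<mu> (u, v) \<noteq> 0" if "u \<in> carrier A" "v \<in> carrier A" for u v
    using nz[OF that] by auto
  let ?a = "restrict \<alpha> (carrier A \<times> carrier A)" and ?m = "restrict \<mu> (carrier A \<times> carrier A)"
  show "?a (y, z) \<otimes>\<^bsub>Cstar\<^esub> inv\<^bsub>Cstar\<^esub> ?a (x \<oplus> y, z) \<otimes>\<^bsub>Cstar\<^esub> ?a (x, y \<oplus> z) \<otimes>\<^bsub>Cstar\<^esub> inv\<^bsub>Cstar\<^esub> ?a (x, y)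
      = \<one>\<^bsub>Cstar\<^esub>"
    using assms(3)[of x y z] by (simp add: field_simps)
  show "?m (y, z) \<otimes>\<^bsub>Cstar\<^esub> inv\<^bsub>Cstar\<^esub> ?m (x \<otimes> y, z) \<otimes>\<^bsub>Cstar\<^esub> ?m (x, y \<otimes> z) \<otimes>\<^bsub>Cstar\<^esub> inv\<^bsub>Cstar\<^esub> ?m (x, y)
      = \<one>\<^bsub>Cstar\<^esub>"
    using assms(4)[of x y z] by (simp add: field_simps)
  show "?a (y, z) \<otimes>\<^bsub>Cstar\<^esub> ?m (x, y \<oplus> z) \<otimes>\<^bsub>Cstar\<^esub> ?a (\<ominus> x, x)
      = ?m (x, z) \<otimes>\<^bsub>Cstar\<^esub> ?a (x \<otimes> y, \<ominus> x) \<otimes>\<^bsub>Cstar\<^esub> ?a ((x \<otimes> y) \<ominus> x, x \<otimes> z) \<otimes>\<^bsub>Cstar\<^esub> ?m (x, y)"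
    using assms(5)[of x y z] by simp
qed (use assms(1,2) in auto)

lemma (in skew_brace)
  assumes "factor_set A Cstar \<alpha> \<mu>"
  shows factor_set_nonzero:
      "\<And>x y. \<lbrakk>x \<in> carrier A; y \<in> carrier A\<rbrakk> \<Longrightarrow> \<alpha> (x, y) \<noteq> 0"
      "\<And>x y. \<lbrakk>x \<in> carrier A; y \<in> carrier A\<rbrakk> \<Longrightarrow> \<mu> (x, y) \<noteq> 0"
    and factor_set_normalized:
      "\<And>x. x \<in> carrier A \<Longrightarrow> \<alpha> (\<zero>, x) = 1" "\<And>x. x \<in> carrier A \<Longrightarrow> \<mu> (\<zero>, x) = 1"
    and factor_set_add_cocycle:
      "\<And>x y z. \<lbrakk>x \<in> carrier A; y \<in> carrier A; z \<in> carrier A\<rbrakk>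
        \<Longrightarrow> \<alpha> (y, z) * \<alpha> (x, y \<oplus> z) = \<alpha> (x, y) * \<alpha> (x \<oplus> y, z)"
    and factor_set_circ_cocycle:
      "\<And>x y z. \<lbrakk>x \<in> carrier A; y \<in> carrier A; z \<in> carrier A\<rbrakk>
        \<Longrightarrow> \<mu> (y, z) * \<mu> (x, y \<otimes> z) = \<mu> (x, y) * \<mu> (x \<otimes> y, z)"
    and factor_set_compat:
      "\<And>x y z. \<lbrakk>x \<in> carrier A; y \<in> carrier A; z \<in> carrier A\<rbrakk>
        \<Longrightarrow> \<alpha> (y, z) * \<mu> (x, y \<oplus> z) * \<alpha> (\<ominus> x, x)
          = \<mu> (x, z) * \<alpha> (x \<otimes> y, \<ominus> x) * \<alpha> ((x \<otimes> y) \<ominus> x, x \<otimes> z) * \<mu> (x, y)"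
proof -
  have mem: "\<alpha> \<in> carrier A \<times> carrier A \<rightarrow>\<^sub>E carrier Cstar" "\<mu> \<in> carrier A \<times> carrier A \<rightarrow>\<^sub>E carrier Cstar"
    using assms by (auto simp: factor_set_def)
  note eqs = assms[unfolded factor_set_def, THEN conjunct2, THEN conjunct2, rule_format]
  have a [simp]: "\<alpha> (x, y) \<noteq> 0" if "x \<in> carrier A" "y \<in> carrier A" for x y
    using PiE_mem[OF mem(1), of "(x, y)"] that by simp
  have m [simp]: "\<mu> (x, y) \<noteq> 0" if "x \<in> carrier A" "y \<in> carrier A" for x y
    using PiE_mem[OF mem(2), of "(x, y)"] that by simp
  show "\<And>x y. \<lbrakk>x \<in> carrier A; y \<in> carrier A\<rbrakk> \<Longrightarrow> \<alpha> (x, y) \<noteq> 0" by simp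
  show "\<And>x y. \<lbrakk>x \<in> carrier A; y \<in> carrier A\<rbrakk> \<Longrightarrow> \<mu> (x, y) \<noteq> 0" by simp
  fix x assume x [simp]: "x \<in> carrier A"
  \<comment> \<open>The normalisation clauses stand under the quantifier over all triples, so the
    diagonal triple yields them.\<close>
  show "\<alpha> (\<zero>, x) = 1" "\<mu> (\<zero>, x) = 1" using eqs[of x x x] by auto
  fix y z assume [simp]: "y \<in> carrier A" "z \<in> carrier A"
  show "\<alpha> (y, z) * \<alpha> (x, y \<oplus> z) = \<alpha> (x, y) * \<alpha> (x \<oplus> y, z)"
    using eqs[of x y z] by (simp add: field_simps)
  show "\<mu> (y, z) * \<mu> (x, y \<otimes> z) = \<mu> (x, y) * \<mu> (x \<otimes> y, z)"
    using eqs[of x y z] by (simp add: field_simps)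
  show "\<alpha> (y, z) * \<mu> (x, y \<oplus> z) * \<alpha> (\<ominus> x, x)
          = \<mu> (x, z) * \<alpha> (x \<otimes> y, \<ominus> x) * \<alpha> ((x \<otimes> y) \<ominus> x, x \<otimes> z) * \<mu> (x, y)"
    using eqs[of x y z] by simp
qed

text \<open>Unfolding the coset turns membership in a cohomology class into the existence of a
  cobounding map h.\<close>

lemma B2b_coset_iff:
  "(u, v) \<in> B2b Q Cstar #>\<^bsub>Z2b Q Cstar\<^esub> (\<alpha>, \<mu>) \<longleftrightarrow>
    (\<exists>h. (\<forall>x\<in>carrier Q. h x \<noteq> 0) \<and> h \<zero>\<^bsub>Q\<^esub> = 1 \<and>
      u = (\<lambda>p \<in> carrier Q \<times> carrier Q. coboundary_add Q Cstar h p * \<alpha> p) \<and>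
      v = (\<lambda>p \<in> carrier Q \<times> carrier Q. coboundary_circ Q Cstar h p * \<mu> p))"
  unfolding r_coset_def B2b_def Z2b_def by (auto simp: Pi_def)

section \<open>Equality of classes modulo coboundaries\<close>

context skew_brace
begin

lemma coboundary_add_Cstar:
  "\<lbrakk>\<forall>x\<in>carrier A. h x \<noteq> 0; x \<in> carrier A; y \<in> carrier A\<rbrakk>
    \<Longrightarrow> coboundary_add A Cstar h (x, y) = h x * h y / h (x \<oplus> y)"
  by (simp add: coboundary_add_def field_simps)

lemma coboundary_circ_Cstar:
  "\<lbrakk>\<forall>x\<in>carrier A. h x \<noteq> 0; x \<in> carrier A; y \<in> carrier A\<rbrakk>
    \<Longrightarrow> coboundary_circ A Cstar h (x, y) = h x * h y / h (x \<otimes> y)"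
  by (simp add: coboundary_circ_def field_simps)

text \<open>Coboundaries multiply: a pair that differs from (\<alpha>, \<mu>) by the coboundary of g
  differs from (\<alpha>', \<mu>') by that of g h.\<close>

lemma B2b_coset_mono:
  assumes h: "\<forall>x\<in>carrier A. h x \<noteq> 0" "h \<zero> = 1"
    and a: "\<And>x y. \<lbrakk>x \<in> carrier A; y \<in> carrier A\<rbrakk> \<Longrightarrow> \<alpha> (x, y) = h x * h y / h (x \<oplus> y) * \<alpha>' (x, y)"
    and m: "\<And>x y. \<lbrakk>x \<in> carrier A; y \<in> carrier A\<rbrakk> \<Longrightarrow> \<mu> (x, y) = h x * h y / h (x \<otimes> y) * \<mu>' (x, y)"
  shows "B2b A Cstar #>\<^bsub>Z2b A Cstar\<^esub> (\<alpha>, \<mu>) \<subseteq> B2b A Cstar #>\<^bsub>Z2b A Cstar\<^esub> (\<alpha>', \<mu>')"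
proof
  fix w assume "w \<in> B2b A Cstar #>\<^bsub>Z2b A Cstar\<^esub> (\<alpha>, \<mu>)"
  then obtain u v where w: "w = (u, v)" and "(u, v) \<in> B2b A Cstar #>\<^bsub>Z2b A Cstar\<^esub> (\<alpha>, \<mu>)"
    by (cases w) auto
  then obtain g where g: "\<forall>x\<in>carrier A. g x \<noteq> 0" "g \<zero> = 1"
      "u = (\<lambda>p \<in> carrier A \<times> carrier A. coboundary_add A Cstar g p * \<alpha> p)"
      "v = (\<lambda>p \<in> carrier A \<times> carrier A. coboundary_circ A Cstar g p * \<mu> p)"
    unfolding B2b_coset_iff by blast
  have gh: "\<forall>x\<in>carrier A. g x * h x \<noteq> 0" using g h by auto
  have "(u, v) \<in> B2b A Cstar #>\<^bsub>Z2b A Cstar\<^esub> (\<alpha>', \<mu>')"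
    unfolding B2b_coset_iff
  proof (intro exI[of _ "\<lambda>x. g x * h x"] conjI)
    show "u = (\<lambda>p \<in> carrier A \<times> carrier A. coboundary_add A Cstar (\<lambda>x. g x * h x) p * \<alpha>' p)"
      unfolding g(3) using coboundary_add_Cstar[OF g(1)] coboundary_add_Cstar[OF gh]
      by (intro restrict_ext) (auto simp: a)
    show "v = (\<lambda>p \<in> carrier A \<times> carrier A. coboundary_circ A Cstar (\<lambda>x. g x * h x) p * \<mu>' p)"
      unfolding g(4) using coboundary_circ_Cstar[OF g(1)] coboundary_circ_Cstar[OF gh]
      by (intro restrict_ext) (auto simp: m)
  qed (use g h in auto)
  then show "w \<in> B2b A Cstar #>\<^bsub>Z2b A Cstar\<^esub> (\<alpha>', \<mu>')" using w by simp
qed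

lemma B2b_coset_eqI:
  assumes h: "\<forall>x\<in>carrier A. h x \<noteq> 0" "h \<zero> = 1"
    and a: "\<And>x y. \<lbrakk>x \<in> carrier A; y \<in> carrier A\<rbrakk> \<Longrightarrow> \<alpha> (x, y) = h x * h y / h (x \<oplus> y) * \<alpha>' (x, y)"
    and m: "\<And>x y. \<lbrakk>x \<in> carrier A; y \<in> carrier A\<rbrakk> \<Longrightarrow> \<mu> (x, y) = h x * h y / h (x \<otimes> y) * \<mu>' (x, y)"
  shows "B2b A Cstar #>\<^bsub>Z2b A Cstar\<^esub> (\<alpha>, \<mu>) = B2b A Cstar #>\<^bsub>Z2b A Cstar\<^esub> (\<alpha>', \<mu>')"
proof
  \<comment> \<open>The relation between the two pairs is symmetric, with 1/h in place of h.\<close>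
  show "B2b A Cstar #>\<^bsub>Z2b A Cstar\<^esub> (\<alpha>', \<mu>') \<subseteq> B2b A Cstar #>\<^bsub>Z2b A Cstar\<^esub> (\<alpha>, \<mu>)"
    by (rule B2b_coset_mono[of "\<lambda>x. inverse (h x)"]) (use h a m in \<open>auto simp: field_simps\<close>)
qed (rule B2b_coset_mono[OF assms])

end


section \<open>Matrices up to scalars\<close>

lemma GL_simps [simp]: "A \<otimes>\<^bsub>GL n\<^esub> B = A * B" "\<one>\<^bsub>GL n\<^esub> = 1\<^sub>m n"
  by (simp_all add: GL_def units_of_def ring_mat_def)

lemma group_GL: "group (GL n)"
proof -
  interpret R: ring "ring_mat TYPE(complex) n ()" by (rule ring_mat)
  show ?thesis unfolding GL_def by (rule R.units_group)
qed

lemma GL_mat: "A \<in> carrier (GL n) \<Longrightarrow> A \<in> carrier_mat n n"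
  by (simp add: GL_def units_of_def Units_def ring_mat_def)

lemma GL_I: "\<lbrakk>A \<in> carrier_mat n n; B \<in> carrier_mat n n; A * B = 1\<^sub>m n; B * A = 1\<^sub>m n\<rbrakk> \<Longrightarrow> A \<in> carrier (GL n)"
  by (auto simp: GL_def units_of_def Units_def ring_mat_def)

lemma smult_smult_times: "a \<cdot>\<^sub>m (b \<cdot>\<^sub>m M) = (a * b) \<cdot>\<^sub>m (M :: complex mat)"
  by (rule eq_matI) (auto simp: mult.assoc)

lemma smult_smult_mult:
  assumes "A \<in> carrier (GL n)" "B \<in> carrier (GL n)"
  shows "(c \<cdot>\<^sub>m A) * (d \<cdot>\<^sub>m B) = (c * d) \<cdot>\<^sub>m (A * B)"
  using GL_mat[OF assms(1)] GL_mat[OF assms(2)]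
  by (simp add: mult_smult_distrib[of _ n n] mult_smult_assoc_mat[of _ n n] smult_smult_times mult.commute)

lemma smult_mult:
  assumes "A \<in> carrier (GL n)" "B \<in> carrier (GL n)"
  shows "(c \<cdot>\<^sub>m A) * B = c \<cdot>\<^sub>m (A * B)" "A * (c \<cdot>\<^sub>m B) = c \<cdot>\<^sub>m (A * B)"
  using GL_mat[OF assms(1)] GL_mat[OF assms(2)]
  by (simp_all add: mult_smult_distrib[of _ n n] mult_smult_assoc_mat[of _ n n])

lemma one_smult [simp]: "(1 :: complex) \<cdot>\<^sub>m A = A"
  by (rule eq_matI) auto

lemma GL_mult [simp]: "\<lbrakk>A \<in> carrier (GL n); B \<in> carrier (GL n)\<rbrakk> \<Longrightarrow> A * B \<in> carrier (GL n)"
  using group.subgroup_self[OF group_GL, of n] subgroup.m_closed by fastforce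

lemma GL_inv:
  assumes "A \<in> carrier (GL n)"
  shows "inv\<^bsub>GL n\<^esub> A \<in> carrier (GL n)" "A * inv\<^bsub>GL n\<^esub> A = 1\<^sub>m n" "inv\<^bsub>GL n\<^esub> A * A = 1\<^sub>m n"
  using group.inv_closed[OF group_GL assms] group.r_inv[OF group_GL assms] group.l_inv[OF group_GL assms]
  by auto

lemma GL_assoc: "\<lbrakk>A \<in> carrier (GL n); B \<in> carrier (GL n); C \<in> carrier (GL n)\<rbrakk> \<Longrightarrow> A * B * C = A * (B * C)"
  by (meson GL_mat assoc_mult_mat)

lemma GL_one [simp]: "1\<^sub>m n \<in> carrier (GL n)"
  using group.is_monoid[OF group_GL, of n] monoid.one_closed by fastforce

lemma GL_mult_one [simp]: "A \<in> carrier (GL n) \<Longrightarrow> A * 1\<^sub>m n = A" "A \<in> carrier (GL n) \<Longrightarrow> 1\<^sub>m n * A = A"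
  by (auto dest: GL_mat)

lemma GL_smult [simp]:
  assumes "c \<noteq> 0" "A \<in> carrier (GL n)"
  shows "c \<cdot>\<^sub>m A \<in> carrier (GL n)"
proof (rule GL_I)
  note [simp] = GL_inv[OF assms(2)] GL_mat[OF assms(2)] GL_mat[OF GL_inv(1)[OF assms(2)]]
  show "inverse c \<cdot>\<^sub>m inv\<^bsub>GL n\<^esub> A \<in> carrier_mat n n" "c \<cdot>\<^sub>m A \<in> carrier_mat n n" by auto
  show "c \<cdot>\<^sub>m A * (inverse c \<cdot>\<^sub>m inv\<^bsub>GL n\<^esub> A) = 1\<^sub>m n" "inverse c \<cdot>\<^sub>m inv\<^bsub>GL n\<^esub> A * (c \<cdot>\<^sub>m A) = 1\<^sub>m n"
    using assms by (simp_all add: smult_smult_mult[of _ n])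
qed

lemma inv_GL_smult:
  assumes "c \<noteq> 0" "A \<in> carrier (GL n)"
  shows "inv\<^bsub>GL n\<^esub> (c \<cdot>\<^sub>m A) = inverse c \<cdot>\<^sub>m inv\<^bsub>GL n\<^esub> A"
  using assms by (intro group.inv_equality[OF group_GL]) (auto simp: smult_smult_mult[of _ n] GL_inv)

text \<open>Multiplying by the inverse of A leaves scalar matrices, whose entries at (0, 0) are
  compared; n \<ge> 1 provides that entry. Equations between multipliers are extracted from matrix
  identities in this way.\<close>

lemma GL_smult_cancel:
  assumes "A \<in> carrier (GL n)" "n \<ge> 1" "c \<cdot>\<^sub>m A = d \<cdot>\<^sub>m A"
  shows "c = d"
proof -
  have "c \<cdot>\<^sub>m A * inv\<^bsub>GL n\<^esub> A = d \<cdot>\<^sub>m A * inv\<^bsub>GL n\<^esub> A" using assms(3) by simp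
  then have "c \<cdot>\<^sub>m 1\<^sub>m n = d \<cdot>\<^sub>m (1\<^sub>m n :: complex mat)"
    using assms(1) by (simp add: smult_mult[of _ n] GL_inv)
  then have "(c \<cdot>\<^sub>m 1\<^sub>m n) $$ (0,0) = (d \<cdot>\<^sub>m (1\<^sub>m n :: complex mat)) $$ (0,0)" by simp
  then show ?thesis using assms(2) by simp
qed

text \<open>The class of an invertible matrix is the set of its nonzero scalar multiples, and two
  such sets coincide as soon as their representatives are proportional.\<close>

lemma PGL_class_eq:
  assumes A: "A \<in> carrier (GL n)" and B: "B \<in> carrier (GL n)"
  shows "PGL_class n A = PGL_class n B \<longleftrightarrow> (\<exists>c. c \<noteq> 0 \<and> A = c \<cdot>\<^sub>m B)"
proof -
  have cl: "PGL_class n M = {c \<cdot>\<^sub>m M |c. c \<noteq> 0}" if "M \<in> carrier (GL n)" for M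
    using that by (auto simp: PGL_class_def r_coset_def nonzero_scalars_def smult_mult[of _ n])
  have "A \<in> PGL_class n A" using cl[OF A] by (auto intro!: exI[of _ 1])
  moreover have "PGL_class n A = PGL_class n B" if "c \<noteq> 0" "A = c \<cdot>\<^sub>m B" for c
  proof -
    have "\<exists>e. d \<cdot>\<^sub>m B = e \<cdot>\<^sub>m A \<and> e \<noteq> 0" if "d \<noteq> 0" for d
      using that \<open>c \<noteq> 0\<close> \<open>A = c \<cdot>\<^sub>m B\<close> by (intro exI[of _ "d / c"]) (simp add: smult_smult_times)
    moreover have "\<exists>e. d \<cdot>\<^sub>m A = e \<cdot>\<^sub>m B \<and> e \<noteq> 0" if "d \<noteq> 0" for d
      using that \<open>c \<noteq> 0\<close> \<open>A = c \<cdot>\<^sub>m B\<close> by (intro exI[of _ "d * c"]) (simp add: smult_smult_times)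
    ultimately show ?thesis unfolding cl[OF A] cl[OF B] by auto
  qed
  ultimately show ?thesis using cl[OF B] by auto
qed


section \<open>Projective representations of skew braces\<close>

text \<open>Each condition equates two evaluations of one matrix product, from which an invertible
  factor is cancelled. Products with the identity give the normalisation, associativity gives the
  two cocycle conditions, and multiplicativity of conjugation by \<rho> x gives the mixed
  one.\<close>

lemma (in skew_brace) projective_brace_representation_factor_set:
  assumes n: "n \<ge> 1"
    and nz: "\<alpha> \<in> carrier A \<times> carrier A \<rightarrow> carrier Cstar" "\<mu> \<in> carrier A \<times> carrier A \<rightarrow> carrier Cstar"
    and rep: "projective_brace_representation n A \<alpha> \<mu> \<beta> \<rho>"
  shows "factor_set A Cstar (restrict \<alpha> (carrier A \<times> carrier A)) (restrict \<mu> (carrier A \<times> carrier A))"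
proof (rule factor_set_CstarI)
  have [simp]: "\<alpha> (x, y) \<noteq> 0" "\<mu> (x, y) \<noteq> 0" if "x \<in> carrier A" "y \<in> carrier A" for x y
    using nz that by (force simp: Pi_def)+
  show "\<alpha> (x, y) \<noteq> 0 \<and> \<mu> (x, y) \<noteq> 0" if "x \<in> carrier A" "y \<in> carrier A" for x y
    using that by simp
  have B [simp]: "\<beta> x \<in> carrier (GL n)" and R [simp]: "\<rho> x \<in> carrier (GL n)" if "x \<in> carrier A" for x
    using rep that by (auto simp: projective_brace_representation_def)
  have BB: "\<beta> x * \<beta> y = \<alpha> (x, y) \<cdot>\<^sub>m \<beta> (x \<oplus> y)" and RR: "\<rho> x * \<rho> y = \<mu> (x, y) \<cdot>\<^sub>m \<rho> (x \<otimes> y)"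
    and RB: "\<rho> x * \<beta> y * inv\<^bsub>GL n\<^esub> \<rho> x * \<beta> x = \<mu> (x, y) \<cdot>\<^sub>m \<beta> (x \<otimes> y)"
    if "x \<in> carrier A" "y \<in> carrier A" for x y
    using rep that by (auto simp: projective_brace_representation_def)
  have B0: "\<beta> \<zero> = 1\<^sub>m n" and R0: "\<rho> \<zero> = 1\<^sub>m n"
    using rep by (auto simp: projective_brace_representation_def)
  note sm = smult_mult[of _ n] smult_smult_times
  have z1: "\<zero> \<otimes> x = x" "x \<otimes> \<zero> = x" if "x \<in> carrier A" for x
    using that by (auto simp flip: one_eq_zero)
  show "\<alpha> (\<zero>, x) = 1 \<and> \<alpha> (x, \<zero>) = 1 \<and> \<mu> (\<zero>, x) = 1 \<and> \<mu> (x, \<zero>) = 1" if [simp]: "x \<in> carrier A" for x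
    using BB[of \<zero> x] BB[of x \<zero>] RR[of \<zero> x] RR[of x \<zero>] n
      GL_smult_cancel[of "\<beta> x" n 1] GL_smult_cancel[of "\<rho> x" n 1]
    by (simp add: B0 R0 z1)
  fix x y z assume [simp]: "x \<in> carrier A" "y \<in> carrier A" "z \<in> carrier A"
  have "\<beta> x * \<beta> y * \<beta> z = \<beta> x * (\<beta> y * \<beta> z)" by (simp add: GL_assoc[of _ n])
  then have "(\<alpha> (x, y) * \<alpha> (x \<oplus> y, z)) \<cdot>\<^sub>m \<beta> (x \<oplus> y \<oplus> z) = (\<alpha> (y, z) * \<alpha> (x, y \<oplus> z)) \<cdot>\<^sub>m \<beta> (x \<oplus> y \<oplus> z)"
    by (simp add: BB sm add.m_assoc)
  from GL_smult_cancel[OF B n this]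
  show "\<alpha> (y, z) * \<alpha> (x, y \<oplus> z) = \<alpha> (x, y) * \<alpha> (x \<oplus> y, z)" by simp
  have "\<rho> x * \<rho> y * \<rho> z = \<rho> x * (\<rho> y * \<rho> z)" by (simp add: GL_assoc[of _ n])
  then have "(\<mu> (x, y) * \<mu> (x \<otimes> y, z)) \<cdot>\<^sub>m \<rho> (x \<otimes> y \<otimes> z) = (\<mu> (y, z) * \<mu> (x, y \<otimes> z)) \<cdot>\<^sub>m \<rho> (x \<otimes> y \<otimes> z)"
    by (simp add: RR sm circ.m_assoc)
  from GL_smult_cancel[OF R n this]
  show "\<mu> (y, z) * \<mu> (x, y \<otimes> z) = \<mu> (x, y) * \<mu> (x \<otimes> y, z)" by simp
  let ?C = "\<lambda>M. \<rho> x * M * inv\<^bsub>GL n\<^esub> \<rho> x"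
  note [simp] = GL_inv[OF R]
  have C: "?C M \<in> carrier (GL n)" if "M \<in> carrier (GL n)" for M using that by simp
  \<comment> \<open>Both bracketings of \<beta> x \<beta>(-x) \<beta> x are scalar multiples of
    \<beta> x, since \<beta> 0 is the identity.\<close>
  have comm: "\<alpha> (x, \<ominus> x) = \<alpha> (\<ominus> x, x)"
  proof -
    have "\<beta> x * \<beta> (\<ominus> x) * \<beta> x = \<beta> x * (\<beta> (\<ominus> x) * \<beta> x)" by (simp add: GL_assoc[of _ n])
    then have "\<alpha> (x, \<ominus> x) \<cdot>\<^sub>m \<beta> x = \<alpha> (\<ominus> x, x) \<cdot>\<^sub>m \<beta> x" by (simp add: BB B0 sm)
    from GL_smult_cancel[OF B n this] show ?thesis by simp
  qed
  \<comment> \<open>To isolate the conjugate of \<beta> y in the third relation, \<beta> x is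
    removed by multiplying with \<beta>(-x), up to the scalar \<alpha>(-x, x). The result, in
    \<open>conj\<close>, is a multiple of \<beta>(x \<circ> y - x).\<close>
  have "?C (\<beta> y) * \<beta> x * \<beta> (\<ominus> x) = (\<mu> (x, y) * \<alpha> (x \<otimes> y, \<ominus> x)) \<cdot>\<^sub>m \<beta> ((x \<otimes> y) \<ominus> x)"
    by (simp add: RB BB sm a_minus_def)
  moreover have "?C (\<beta> y) * \<beta> x * \<beta> (\<ominus> x) = \<alpha> (\<ominus> x, x) \<cdot>\<^sub>m ?C (\<beta> y)"
  proof -
    have "?C (\<beta> y) * \<beta> x * \<beta> (\<ominus> x) = ?C (\<beta> y) * (\<beta> x * \<beta> (\<ominus> x))"
      by (rule GL_assoc[of _ n]) simp_all
    then show ?thesis by (simp add: BB B0 sm comm)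
  qed
  ultimately have conj: "\<alpha> (\<ominus> x, x) \<cdot>\<^sub>m ?C (\<beta> y) = (\<mu> (x, y) * \<alpha> (x \<otimes> y, \<ominus> x)) \<cdot>\<^sub>m \<beta> ((x \<otimes> y) \<ominus> x)"
    by simp
  \<comment> \<open>The inner \<rho> x cancels against its inverse, so the product of conjugates is
    the conjugate of a product.\<close>
  have "?C (\<beta> y) * (?C (\<beta> z) * \<beta> x) = ?C (\<beta> y * \<beta> z) * \<beta> x"
  proof -
    have 1: "inv\<^bsub>GL n\<^esub> \<rho> x * (\<rho> x * M) = M" if "M \<in> carrier (GL n)" for M
      using that GL_assoc[of "inv\<^bsub>GL n\<^esub> \<rho> x" n "\<rho> x" M] by simp
    show ?thesis by (simp add: GL_assoc[of _ n] 1)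
  qed
  also have "\<dots> = (\<alpha> (y, z) * \<mu> (x, y \<oplus> z)) \<cdot>\<^sub>m \<beta> (x \<otimes> (y \<oplus> z))"
    by (simp add: BB sm RB)
  \<comment> \<open>The factor \<alpha>(-x, x) is inserted so that \<open>conj\<close> can replace
    the first conjugate. The second one absorbs \<beta> x by the third relation, and the brace law
    identifies (x \<circ> y - x) + x \<circ> z with x \<circ> (y + z).\<close>
  finally have "\<alpha> (\<ominus> x, x) \<cdot>\<^sub>m (?C (\<beta> y) * (?C (\<beta> z) * \<beta> x))
      = (\<alpha> (y, z) * \<mu> (x, y \<oplus> z) * \<alpha> (\<ominus> x, x)) \<cdot>\<^sub>m \<beta> (x \<otimes> (y \<oplus> z))"
    by (simp add: smult_smult_times mult_ac)
  moreover have "\<alpha> (\<ominus> x, x) \<cdot>\<^sub>m (?C (\<beta> y) * (?C (\<beta> z) * \<beta> x))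
      = (\<alpha> (\<ominus> x, x) \<cdot>\<^sub>m ?C (\<beta> y)) * (?C (\<beta> z) * \<beta> x)"
    by (rule smult_mult(1)[of _ n, symmetric]) simp_all
  moreover have "\<dots> = (\<mu> (x, z) * \<alpha> (x \<otimes> y, \<ominus> x) * \<alpha> ((x \<otimes> y) \<ominus> x, x \<otimes> z) * \<mu> (x, y)) \<cdot>\<^sub>m \<beta> (x \<otimes> (y \<oplus> z))"
    unfolding conj by (simp add: RB sm BB compat mult_ac)
  ultimately have "(\<alpha> (y, z) * \<mu> (x, y \<oplus> z) * \<alpha> (\<ominus> x, x)) \<cdot>\<^sub>m \<beta> (x \<otimes> (y \<oplus> z))
      = (\<mu> (x, z) * \<alpha> (x \<otimes> y, \<ominus> x) * \<alpha> ((x \<otimes> y) \<ominus> x, x \<otimes> z) * \<mu> (x, y)) \<cdot>\<^sub>m \<beta> (x \<otimes> (y \<oplus> z))"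
    by simp
  from GL_smult_cancel[OF B n this]
  show "\<alpha> (y, z) * \<mu> (x, y \<oplus> z) * \<alpha> (\<ominus> x, x)
      = \<mu> (x, z) * \<alpha> (x \<otimes> y, \<ominus> x) * \<alpha> ((x \<otimes> y) \<ominus> x, x \<otimes> z) * \<mu> (x, y)"
    by simp
qed

section \<open>Monomial matrices indexed by a finite set\<close>

locale monomial_matrices =
  fixes V :: "'q set" and e :: "nat \<Rightarrow> 'q"
  assumes fin: "finite V" and e: "bij_betw e {..<card V} V"
begin

text \<open>The matrix of the linear map sending the basis vector of z to c z times the basis vector
  of f z, where e numbers the basis.\<close>

definition monomial :: "('q \<Rightarrow> 'q) \<Rightarrow> ('q \<Rightarrow> complex) \<Rightarrow> complex mat" where
  "monomial f c = mat (card V) (card V) (\<lambda>(i, j). if e i = f (e j) then c (e j) else 0)"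

lemma monomial_carrier [simp]: "monomial f c \<in> carrier_mat (card V) (card V)"
  by (simp add: monomial_def)

lemma e_in [simp]: "i < card V \<Longrightarrow> e i \<in> V"
  using e by (auto simp: bij_betw_def)

lemma e_eq [simp]: "\<lbrakk>i < card V; j < card V\<rbrakk> \<Longrightarrow> e i = e j \<longleftrightarrow> i = j"
  using e by (auto simp: bij_betw_def inj_on_def)

lemma monomial_cong:
  "\<lbrakk>\<And>x. x \<in> V \<Longrightarrow> f x = g x; \<And>x. x \<in> V \<Longrightarrow> c x = d x\<rbrakk> \<Longrightarrow> monomial f c = monomial g d"
  unfolding monomial_def by (rule cong_mat) auto

lemma monomial_one: "monomial (\<lambda>x. x) (\<lambda>x. 1) = 1\<^sub>m (card V)"
  unfolding monomial_def by (rule eq_matI) auto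

lemma monomial_smult: "s \<cdot>\<^sub>m monomial f c = monomial f (\<lambda>x. s * c x)"
  unfolding monomial_def by (rule eq_matI) auto

lemma monomial_mult:
  assumes "\<And>x. x \<in> V \<Longrightarrow> g x \<in> V"
  shows "monomial f c * monomial g d = monomial (\<lambda>x. f (g x)) (\<lambda>x. c (g x) * d x)"
proof (rule eq_matI)
  fix i j assume "i < dim_row (monomial (\<lambda>x. f (g x)) (\<lambda>x. c (g x) * d x))"
    "j < dim_col (monomial (\<lambda>x. f (g x)) (\<lambda>x. c (g x) * d x))"
  then have ij: "i < card V" "j < card V" by (auto simp: monomial_def)
  \<comment> \<open>The index of g (e j), which exists because g stays inside V; in the sum over the
    inner index only the term at m survives.\<close>
  obtain m where m: "m < card V" "g (e j) = e m"
    using e assms[of "e j"] ij by (metis e_in bij_betw_imp_surj_on imageE lessThan_iff)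
  have "(monomial f c * monomial g d) $$ (i, j)
      = (\<Sum>k<card V. (if e i = f (e k) then c (e k) else 0) * (if e k = g (e j) then d (e j) else 0))"
    using ij by (simp add: monomial_def scalar_prod_def atLeast0LessThan)
  also have "\<dots> = (\<Sum>k<card V. if k = m then (if e i = f (e k) then c (e k) else 0) * d (e j) else 0)"
    using m by (intro sum.cong) auto
  finally show "(monomial f c * monomial g d) $$ (i, j)
      = monomial (\<lambda>x. f (g x)) (\<lambda>x. c (g x) * d x) $$ (i, j)"
    using m ij by (simp add: monomial_def)
qed (simp_all add: monomial_def)

lemma monomial_GL:
  assumes "\<And>x. x \<in> V \<Longrightarrow> f x \<in> V" "\<And>x. x \<in> V \<Longrightarrow> g x \<in> V"
    and "\<And>x. x \<in> V \<Longrightarrow> f (g x) = x" "\<And>x. x \<in> V \<Longrightarrow> g (f x) = x" "\<And>x. x \<in> V \<Longrightarrow> c x \<noteq> 0"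
  shows "monomial f c \<in> carrier (GL (card V))"
proof (rule GL_I)
  \<comment> \<open>Coefficients of the inverse: going back along g undoes the scalar that c
    attaches to g x.\<close>
  let ?d = "\<lambda>x. inverse (c (g x))"
  show "monomial f c * monomial g ?d = 1\<^sub>m (card V)" "monomial g ?d * monomial f c = 1\<^sub>m (card V)"
    unfolding monomial_one[symmetric] by (subst monomial_mult; use assms in \<open>auto intro!: monomial_cong\<close>)+
qed auto

end

text \<open>On basis vectors the relations become identities between coefficients: the first two are
  the cocycle conditions, and the mixed one follows from the compatibility condition and two
  instances of the additive cocycle condition.\<close>

lemma (in skew_brace) twisted_regular_representation:
  assumes fin: "finite (carrier A)" and fs: "factor_set A Cstar \<alpha> \<mu>"
  shows "\<exists>\<beta> \<rho>. projective_brace_representation (card (carrier A)) A \<alpha> \<mu> \<beta> \<rho>"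
proof -
  obtain e where "bij_betw e {..<card (carrier A)} (carrier A)"
    using ex_bij_betw_nat_finite[OF fin] by (auto simp: atLeast0LessThan)
  then interpret monomial_matrices "carrier A" e by unfold_locales (use fin in auto)
  note [simp] = factor_set_nonzero[OF fs] factor_set_normalized[OF fs]
  let ?n = "card (carrier A)"
  define \<beta> where "\<beta> x = monomial (\<lambda>z. x \<oplus> z) (\<lambda>z. \<alpha> (x, z))" for x
  define \<rho> where "\<rho> x = monomial (\<lambda>z. x \<otimes> z) (\<lambda>z. \<mu> (x, z))" for x
  have B [simp]: "\<beta> x \<in> carrier (GL ?n)" if "x \<in> carrier A" for x
    unfolding \<beta>_def
    by (rule monomial_GL[of _ "\<lambda>z. \<ominus> x \<oplus> z"]) (use that in \<open>auto simp flip: add.m_assoc\<close>)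
  have R [simp]: "\<rho> x \<in> carrier (GL ?n)" if "x \<in> carrier A" for x
    unfolding \<rho>_def
    by (rule monomial_GL[of _ "\<lambda>z. inv x \<otimes> z"]) (use that in \<open>auto simp flip: circ.m_assoc\<close>)
  have compat_rep: "\<rho> x * \<beta> y * inv\<^bsub>GL ?n\<^esub> \<rho> x * \<beta> x = \<mu> (x, y) \<cdot>\<^sub>m \<beta> (x \<otimes> y)"
    if [simp]: "x \<in> carrier A" "y \<in> carrier A" for x y
  proof -
    \<comment> \<open>The element w z solves x \<circ> w = x + z. Thus M, monomial along w, is the
      inverse of \<rho> x multiplied by \<beta> x.\<close>
    define w where "w z = inv x \<otimes> (x \<oplus> z)" for z
    have w [simp]: "w z \<in> carrier A" and xw [simp]: "x \<otimes> w z = x \<oplus> z" if "z \<in> carrier A" for z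
      using that by (auto simp: w_def simp flip: circ.m_assoc)
    define M where "M = monomial w (\<lambda>z. \<alpha> (x, z) / \<mu> (x, w z))"
    have "\<rho> x * M = \<beta> x"
      unfolding \<rho>_def \<beta>_def M_def by (subst monomial_mult) (auto intro!: monomial_cong)
    moreover have M: "M \<in> carrier (GL ?n)"
      unfolding M_def
    \<comment> \<open>The inverse permutation of w, found by solving x + u = x \<circ> z for
      u.\<close>
    proof (rule monomial_GL[of _ "\<lambda>z. \<ominus> x \<oplus> (x \<otimes> z)"])
      show "w (\<ominus> x \<oplus> (x \<otimes> z)) = z" if "z \<in> carrier A" for z
        using that unfolding w_def by (simp flip: add.m_assoc circ.m_assoc)
      show "\<ominus> x \<oplus> (x \<otimes> w z) = z" if "z \<in> carrier A" for z
        using that by (simp flip: add.m_assoc)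
    qed auto
    ultimately have "inv\<^bsub>GL ?n\<^esub> \<rho> x * \<beta> x = M"
      using GL_assoc[OF GL_inv(1)[OF R] R M, of x x] GL_inv[OF R, of x] by simp
    then have "\<rho> x * \<beta> y * inv\<^bsub>GL ?n\<^esub> \<rho> x * \<beta> x = \<rho> x * (\<beta> y * M)"
      using M GL_inv(1)[OF R, of x] by (simp add: GL_assoc[of _ ?n])
    also have "\<dots> = monomial (\<lambda>z. x \<otimes> (y \<oplus> w z))
        (\<lambda>z. \<mu> (x, y \<oplus> w z) * (\<alpha> (y, w z) * (\<alpha> (x, z) / \<mu> (x, w z))))"
      unfolding \<rho>_def \<beta>_def M_def by (subst monomial_mult, simp)+ simp
    also have "\<dots> = monomial (\<lambda>z. (x \<otimes> y) \<oplus> z) (\<lambda>z. \<mu> (x, y) * \<alpha> (x \<otimes> y, z))"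
    proof (rule monomial_cong)
      fix z assume z [simp]: "z \<in> carrier A"
      \<comment> \<open>By the brace law x \<circ> (y + w z) = (x \<circ> y - x) + x \<circ> w z,
        and x \<circ> w z = x + z lets -x and x cancel.\<close>
      have "((x \<otimes> y) \<ominus> x) \<oplus> (x \<oplus> z) = (x \<otimes> y) \<oplus> (\<ominus> x \<oplus> (x \<oplus> z))"
        by (simp add: a_minus_def add.m_assoc)
      also have "\<ominus> x \<oplus> (x \<oplus> z) = z" by (simp flip: add.m_assoc)
      finally show "x \<otimes> (y \<oplus> w z) = (x \<otimes> y) \<oplus> z" by (simp add: compat)
      let ?p = "x \<otimes> y"
      \<comment> \<open>Facts 1 to 3 are the compatibility condition at (x, y, w z) and the additive
        cocycle condition at (x \<circ> y, -x, x + z) and (-x, x, z). Multiplied by \<alpha>(-x, x),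
        the wanted equation passes through 1 and 2, and 3 returns that factor for
        cancellation.\<close>
      have 1: "\<alpha> (y, w z) * \<mu> (x, y \<oplus> w z) * \<alpha> (\<ominus> x, x)
          = \<mu> (x, w z) * \<alpha> (?p, \<ominus> x) * \<alpha> (?p \<ominus> x, x \<oplus> z) * \<mu> (x, y)"
        using factor_set_compat[OF fs, of x y "w z"] by simp
      have neg: "\<ominus> x \<oplus> (x \<oplus> z) = z" by (simp flip: add.m_assoc)
      have 2: "\<alpha> (\<ominus> x, x \<oplus> z) * \<alpha> (?p, z) = \<alpha> (?p, \<ominus> x) * \<alpha> (?p \<ominus> x, x \<oplus> z)"
        using factor_set_add_cocycle[OF fs, of ?p "\<ominus> x" "x \<oplus> z"] by (simp add: neg a_minus_def)
      have 3: "\<alpha> (x, z) * \<alpha> (\<ominus> x, x \<oplus> z) = \<alpha> (\<ominus> x, x)"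
        using factor_set_add_cocycle[OF fs, of "\<ominus> x" x z] by simp
      have "\<mu> (x, y \<oplus> w z) * (\<alpha> (y, w z) * \<alpha> (x, z)) * \<alpha> (\<ominus> x, x)
          = \<alpha> (x, z) * (\<alpha> (y, w z) * \<mu> (x, y \<oplus> w z) * \<alpha> (\<ominus> x, x))"
        by (simp add: mult_ac)
      also have "\<dots> = \<alpha> (x, z) * \<mu> (x, w z) * \<mu> (x, y) * (\<alpha> (?p, \<ominus> x) * \<alpha> (?p \<ominus> x, x \<oplus> z))"
        unfolding 1 by (simp add: mult_ac)
      also have "\<dots> = \<mu> (x, y) * \<alpha> (?p, z) * \<mu> (x, w z) * (\<alpha> (x, z) * \<alpha> (\<ominus> x, x \<oplus> z))"
        unfolding 2[symmetric] by (simp add: mult_ac)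
      also note 3
      finally have "\<mu> (x, y \<oplus> w z) * (\<alpha> (y, w z) * \<alpha> (x, z)) * \<alpha> (\<ominus> x, x)
          = \<mu> (x, y) * \<alpha> (?p, z) * \<mu> (x, w z) * \<alpha> (\<ominus> x, x)" .
      then show "\<mu> (x, y \<oplus> w z) * (\<alpha> (y, w z) * (\<alpha> (x, z) / \<mu> (x, w z))) = \<mu> (x, y) * \<alpha> (?p, z)"
        by (simp add: field_simps)
    qed
    finally show ?thesis by (simp add: \<beta>_def monomial_smult)
  qed
  have "projective_brace_representation ?n A \<alpha> \<mu> \<beta> \<rho>"
    unfolding projective_brace_representation_def GL_simps
  proof (intro conjI ballI)
    show "\<beta> \<zero> = 1\<^sub>m ?n" unfolding \<beta>_def monomial_one[symmetric] by (rule monomial_cong) auto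
    \<comment> \<open>Rewriting 0 to 1 exposes the neutral element of \<circ>; the normalisation of
      \<mu> needs it turned back.\<close>
    show "\<rho> \<zero> = 1\<^sub>m ?n" unfolding \<rho>_def monomial_one[symmetric]
      by (rule monomial_cong) (auto simp flip: one_eq_zero, simp add: one_eq_zero)
    fix x y assume [simp]: "x \<in> carrier A" "y \<in> carrier A"
    show "\<beta> x * \<beta> y = \<alpha> (x, y) \<cdot>\<^sub>m \<beta> (x \<oplus> y)"
      unfolding \<beta>_def monomial_smult
      by (subst monomial_mult)
        (auto intro!: monomial_cong simp: add.m_assoc factor_set_add_cocycle[OF fs, symmetric])
    show "\<rho> x * \<rho> y = \<mu> (x, y) \<cdot>\<^sub>m \<rho> (x \<otimes> y)"
      unfolding \<rho>_def monomial_smult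
      by (subst monomial_mult)
        (auto intro!: monomial_cong simp: circ.m_assoc factor_set_circ_cocycle[OF fs, symmetric])
    show "\<rho> x * \<beta> y * inv\<^bsub>GL ?n\<^esub> \<rho> x * \<beta> x = \<mu> (x, y) \<cdot>\<^sub>m \<beta> (x \<otimes> y)" by (rule compat_rep) auto
  qed auto
  then show ?thesis by blast
qed


section \<open>Transgression and lifting\<close>

lemma hom_Cstar:
  assumes "group K" "\<phi> \<in> hom K Cstar"
  shows "k \<in> carrier K \<Longrightarrow> \<phi> k \<noteq> 0"
    and "\<lbrakk>k \<in> carrier K; l \<in> carrier K\<rbrakk> \<Longrightarrow> \<phi> (k \<otimes>\<^bsub>K\<^esub> l) = \<phi> k * \<phi> l"
    and "\<phi> \<one>\<^bsub>K\<^esub> = 1"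
  using assms hom_one[OF assms(2,1) group_Cstar]
  by (auto simp: hom_def Pi_def)

section \<open>Transgressed characters and lifts in coordinates\<close>

context annihilator_extension_section
begin

text \<open>The group and brace laws of A, applied to values of t, are compared in K-coordinates and
  then mapped by \<phi>.\<close>

lemma transgression_factor_set:
  assumes "\<phi> \<in> hom K Cstar"
  shows "factor_set Q Cstar (\<lambda>p \<in> carrier Q \<times> carrier Q. \<phi> (\<alpha>t p)) (\<lambda>p \<in> carrier Q \<times> carrier Q. \<phi> (\<mu>t p))"
proof (rule Q.factor_set_CstarI)
  note \<phi> [simp] = hom_Cstar[OF K.is_group assms]
  show "\<phi> (\<alpha>t (x, y)) \<noteq> 0 \<and> \<phi> (\<mu>t (x, y)) \<noteq> 0" if "x \<in> carrier Q" "y \<in> carrier Q" for x y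
    using that by simp
  have z [simp]: "\<zero>\<^bsub>Q\<^esub> \<otimes>\<^bsub>Q\<^esub> x = x" "x \<otimes>\<^bsub>Q\<^esub> \<zero>\<^bsub>Q\<^esub> = x" if "x \<in> carrier Q" for x
    using that by (auto simp flip: Q.one_eq_zero)
  have zA [simp]: "\<zero>\<^bsub>A\<^esub> \<otimes>\<^bsub>A\<^esub> x = x" "x \<otimes>\<^bsub>A\<^esub> \<zero>\<^bsub>A\<^esub> = x" if "x \<in> carrier A" for x
    using that by (auto simp flip: A.one_eq_zero)
  show "\<phi> (\<alpha>t (\<zero>\<^bsub>Q\<^esub>, x)) = 1 \<and> \<phi> (\<alpha>t (x, \<zero>\<^bsub>Q\<^esub>)) = 1 \<and> \<phi> (\<mu>t (\<zero>\<^bsub>Q\<^esub>, x)) = 1 \<and> \<phi> (\<mu>t (x, \<zero>\<^bsub>Q\<^esub>)) = 1"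
    if [simp]: "x \<in> carrier Q" for x
  proof -
    \<comment> \<open>As t 0 = 0 is neutral for both operations, all four products equal t x, whose
      K-coordinate is 1.\<close>
    have "elt (\<alpha>t (\<zero>\<^bsub>Q\<^esub>, x)) x = elt \<one>\<^bsub>K\<^esub> x" "elt (\<alpha>t (x, \<zero>\<^bsub>Q\<^esub>)) x = elt \<one>\<^bsub>K\<^esub> x"
      "elt (\<mu>t (\<zero>\<^bsub>Q\<^esub>, x)) x = elt \<one>\<^bsub>K\<^esub> x" "elt (\<mu>t (x, \<zero>\<^bsub>Q\<^esub>)) x = elt \<one>\<^bsub>K\<^esub> x"
      using t_add[of "\<zero>\<^bsub>Q\<^esub>" x] t_add[of x "\<zero>\<^bsub>Q\<^esub>"] t_circ[of "\<zero>\<^bsub>Q\<^esub>" x] t_circ[of x "\<zero>\<^bsub>Q\<^esub>"] by simp_all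
    then show ?thesis by (simp add: elt_inject del: elt_one)
  qed
  fix x y z assume [simp]: "x \<in> carrier Q" "y \<in> carrier Q" "z \<in> carrier Q"
  have elt_\<phi>: "\<phi> k = \<phi> l" if "elt k u = elt l u" "k \<in> carrier K" "l \<in> carrier K" "u \<in> carrier Q" for k l u
    using that elt_inject by simp
  \<comment> \<open>Writing values of t as elements with K-coordinate 1 lets \<open>elt_add\<close>
    and \<open>elt_mult\<close> expand the products.\<close>
  have t: "t x = elt \<one>\<^bsub>K\<^esub> x" "t y = elt \<one>\<^bsub>K\<^esub> y" "t z = elt \<one>\<^bsub>K\<^esub> z" by simp_all
  have "t x \<oplus>\<^bsub>A\<^esub> t y \<oplus>\<^bsub>A\<^esub> t z = t x \<oplus>\<^bsub>A\<^esub> (t y \<oplus>\<^bsub>A\<^esub> t z)" by (simp add: A.add.m_assoc)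
  from elt_\<phi>[OF this[unfolded t, simplified elt_add K.one_closed Q.add.m_closed Q.add.m_assoc
        K.m_closed \<alpha>t_closed K.l_one K.r_one \<open>x \<in> carrier Q\<close> \<open>y \<in> carrier Q\<close> \<open>z \<in> carrier Q\<close>]]
  show "\<phi> (\<alpha>t (y, z)) * \<phi> (\<alpha>t (x, y \<oplus>\<^bsub>Q\<^esub> z)) = \<phi> (\<alpha>t (x, y)) * \<phi> (\<alpha>t (x \<oplus>\<^bsub>Q\<^esub> y, z))"
    by simp
  have "t x \<otimes>\<^bsub>A\<^esub> t y \<otimes>\<^bsub>A\<^esub> t z = t x \<otimes>\<^bsub>A\<^esub> (t y \<otimes>\<^bsub>A\<^esub> t z)" by (simp add: A.circ.m_assoc)
  from elt_\<phi>[OF this[unfolded t, simplified elt_mult K.one_closed Q.circ.m_closed Q.circ.m_assoc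
        K.m_closed \<mu>t_closed K.l_one K.r_one \<open>x \<in> carrier Q\<close> \<open>y \<in> carrier Q\<close> \<open>z \<in> carrier Q\<close>]]
  show "\<phi> (\<mu>t (y, z)) * \<phi> (\<mu>t (x, y \<otimes>\<^bsub>Q\<^esub> z)) = \<phi> (\<mu>t (x, y)) * \<phi> (\<mu>t (x \<otimes>\<^bsub>Q\<^esub> y, z))"
    by simp
  \<comment> \<open>The K-coordinate of -t x, fixed by requiring \<open>elt\<close> at i and -x to
    cancel t x. It is the source of \<alpha>(-x, x) in the compatibility condition.\<close>
  define i where "i = inv\<^bsub>K\<^esub> \<alpha>t (\<ominus>\<^bsub>Q\<^esub> x, x)"
  have i [simp]: "i \<in> carrier K" by (simp add: i_def)
  have "elt i (\<ominus>\<^bsub>Q\<^esub> x) \<oplus>\<^bsub>A\<^esub> t x = \<zero>\<^bsub>A\<^esub>"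
    unfolding t by (subst elt_add) (simp_all add: i_def del: elt_one)
  then have neg: "\<ominus>\<^bsub>A\<^esub> t x = elt i (\<ominus>\<^bsub>Q\<^esub> x)"
    using A.add.inv_equality by simp
  have "t x \<otimes>\<^bsub>A\<^esub> (t y \<oplus>\<^bsub>A\<^esub> t z) = ((t x \<otimes>\<^bsub>A\<^esub> t y) \<oplus>\<^bsub>A\<^esub> \<ominus>\<^bsub>A\<^esub> t x) \<oplus>\<^bsub>A\<^esub> (t x \<otimes>\<^bsub>A\<^esub> t z)"
    using A.compat[of "t x" "t y" "t z"] by (simp add: a_minus_def)
  then have "elt (\<alpha>t (y, z) \<otimes>\<^bsub>K\<^esub> \<mu>t (x, y \<oplus>\<^bsub>Q\<^esub> z)) (x \<otimes>\<^bsub>Q\<^esub> (y \<oplus>\<^bsub>Q\<^esub> z))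
      = elt (\<mu>t (x, y) \<otimes>\<^bsub>K\<^esub> i \<otimes>\<^bsub>K\<^esub> \<alpha>t (x \<otimes>\<^bsub>Q\<^esub> y, \<ominus>\<^bsub>Q\<^esub> x) \<otimes>\<^bsub>K\<^esub> \<mu>t (x, z)
          \<otimes>\<^bsub>K\<^esub> \<alpha>t ((x \<otimes>\<^bsub>Q\<^esub> y) \<ominus>\<^bsub>Q\<^esub> x, x \<otimes>\<^bsub>Q\<^esub> z)) (x \<otimes>\<^bsub>Q\<^esub> (y \<oplus>\<^bsub>Q\<^esub> z))"
    unfolding neg unfolding t by (simp add: elt_add elt_mult Q.compat a_minus_def del: elt_one)
  then have "\<phi> (\<alpha>t (y, z)) * \<phi> (\<mu>t (x, y \<oplus>\<^bsub>Q\<^esub> z))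
      = (\<phi> (\<mu>t (x, z)) * \<phi> (\<alpha>t (x \<otimes>\<^bsub>Q\<^esub> y, \<ominus>\<^bsub>Q\<^esub> x)) * \<phi> (\<alpha>t ((x \<otimes>\<^bsub>Q\<^esub> y) \<ominus>\<^bsub>Q\<^esub> x, x \<otimes>\<^bsub>Q\<^esub> z))
          * \<phi> (\<mu>t (x, y))) * \<phi> i"
    by (auto dest!: elt_\<phi> simp: mult_ac)
  moreover have "\<phi> i * \<phi> (\<alpha>t (\<ominus>\<^bsub>Q\<^esub> x, x)) = 1"
    using \<phi>(2)[of i "\<alpha>t (\<ominus>\<^bsub>Q\<^esub> x, x)"] by (simp add: i_def)
  ultimately show "\<phi> (\<alpha>t (y, z)) * \<phi> (\<mu>t (x, y \<oplus>\<^bsub>Q\<^esub> z)) * \<phi> (\<alpha>t (\<ominus>\<^bsub>Q\<^esub> x, x))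
        = \<phi> (\<mu>t (x, z)) * \<phi> (\<alpha>t (x \<otimes>\<^bsub>Q\<^esub> y, \<ominus>\<^bsub>Q\<^esub> x)) * \<phi> (\<alpha>t ((x \<otimes>\<^bsub>Q\<^esub> y) \<ominus>\<^bsub>Q\<^esub> x, x \<otimes>\<^bsub>Q\<^esub> z)) * \<phi> (\<mu>t (x, y))"
    by (simp only: mult.assoc mult_1_right)
qed

text \<open>When two lifted matrices are multiplied, the coboundary part of the multiplier replaces
  the two factors 1/h by the one at the product, and the rest is \<phi> of the cocycle, as the
  product in A demands. In the mixed relation the scalar of \<rho> cancels with that of its
  inverse.\<close>

lemma can_be_lifted_if_cohomologous:
  assumes \<phi>: "\<phi> \<in> hom K Cstar"
    and h: "\<forall>x\<in>carrier Q. h x \<noteq> 0"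
    and a: "\<And>x y. \<lbrakk>x \<in> carrier Q; y \<in> carrier Q\<rbrakk> \<Longrightarrow> \<alpha>\<^sub>1 (x, y) = h x * h y / h (x \<oplus>\<^bsub>Q\<^esub> y) * \<phi> (\<alpha>t (x, y))"
    and m: "\<And>x y. \<lbrakk>x \<in> carrier Q; y \<in> carrier Q\<rbrakk> \<Longrightarrow> \<mu>\<^sub>1 (x, y) = h x * h y / h (x \<otimes>\<^bsub>Q\<^esub> y) * \<phi> (\<mu>t (x, y))"
    and rep: "projective_brace_representation n Q \<alpha>\<^sub>1 \<mu>\<^sub>1 \<beta>\<^sub>1 \<rho>\<^sub>1"
  shows "can_be_lifted n A \<pi> \<beta>\<^sub>1 \<rho>\<^sub>1"
proof -
  note [simp] = hom_Cstar[OF K.is_group \<phi>]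
  have [simp]: "h x \<noteq> 0" if "x \<in> carrier Q" for x using h that by simp
  have B [simp]: "\<beta>\<^sub>1 x \<in> carrier (GL n)" and R [simp]: "\<rho>\<^sub>1 x \<in> carrier (GL n)" if "x \<in> carrier Q" for x
    using rep that by (auto simp: projective_brace_representation_def)
  have BB: "\<beta>\<^sub>1 x * \<beta>\<^sub>1 y = \<alpha>\<^sub>1 (x, y) \<cdot>\<^sub>m \<beta>\<^sub>1 (x \<oplus>\<^bsub>Q\<^esub> y)" and RR: "\<rho>\<^sub>1 x * \<rho>\<^sub>1 y = \<mu>\<^sub>1 (x, y) \<cdot>\<^sub>m \<rho>\<^sub>1 (x \<otimes>\<^bsub>Q\<^esub> y)"
    and RB: "\<rho>\<^sub>1 x * \<beta>\<^sub>1 y * inv\<^bsub>GL n\<^esub> \<rho>\<^sub>1 x * \<beta>\<^sub>1 x = \<mu>\<^sub>1 (x, y) \<cdot>\<^sub>m \<beta>\<^sub>1 (x \<otimes>\<^bsub>Q\<^esub> y)"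
    if "x \<in> carrier Q" "y \<in> carrier Q" for x y
    using rep that by (auto simp: projective_brace_representation_def)
  \<comment> \<open>The K-coordinate of a, unique by \<open>elt_inject\<close>; off the carrier of A
    its value is left open.\<close>
  define \<kappa> where "\<kappa> a = (THE k. k \<in> carrier K \<and> a = elt k (\<pi> a))" for a
  have \<kappa> [simp]: "\<kappa> (elt k x) = k" if "k \<in> carrier K" "x \<in> carrier Q" for k x
    unfolding \<kappa>_def by (rule the_equality) (use that elt_inject in auto)
  define \<beta> where "\<beta> a = (\<phi> (\<kappa> a) / h (\<pi> a)) \<cdot>\<^sub>m \<beta>\<^sub>1 (\<pi> a)" for a
  define \<rho> where "\<rho> a = (\<phi> (\<kappa> a) / h (\<pi> a)) \<cdot>\<^sub>m \<rho>\<^sub>1 (\<pi> a)" for a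
  have BE: "\<beta> (elt k x) = (\<phi> k / h x) \<cdot>\<^sub>m \<beta>\<^sub>1 x" and RE: "\<rho> (elt k x) = (\<phi> k / h x) \<cdot>\<^sub>m \<rho>\<^sub>1 x"
    if "k \<in> carrier K" "x \<in> carrier Q" for k x
    using that by (auto simp: \<beta>_def \<rho>_def)
  have cl: "\<beta> a \<in> carrier (GL n)" "\<rho> a \<in> carrier (GL n)" if "a \<in> carrier A" for a
    using elt_cases[OF that] by (metis BE RE B R GL_smult divide_eq_0_iff hom_Cstar(1)[OF K.is_group \<phi>] h)+
  have "brace_representation n A \<beta> \<rho>"
    unfolding brace_representation_def
  proof (intro conjI ballI homI)
    fix a b assume "a \<in> carrier (add_monoid A)" "b \<in> carrier (add_monoid A)"
    then have "a \<in> carrier A" "b \<in> carrier A" by auto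
    then obtain k x l y where [simp]: "k \<in> carrier K" "x \<in> carrier Q" "l \<in> carrier K" "y \<in> carrier Q"
      and ab: "a = elt k x" "b = elt l y" by (metis elt_cases)
    have "\<beta> (a \<oplus>\<^bsub>A\<^esub> b) = \<beta> a * \<beta> b"
      unfolding ab by (simp add: elt_add BE smult_smult_mult[of _ n] BB smult_smult_times a mult_ac)
    then show "\<beta> (a \<otimes>\<^bsub>add_monoid A\<^esub> b) = \<beta> a \<otimes>\<^bsub>GL n\<^esub> \<beta> b" by simp
  next
    fix a b assume "a \<in> carrier A" "b \<in> carrier A"
    then obtain k x l y where [simp]: "k \<in> carrier K" "x \<in> carrier Q" "l \<in> carrier K" "y \<in> carrier Q"
      and ab: "a = elt k x" "b = elt l y" by (metis elt_cases)
    show "\<rho> (a \<otimes>\<^bsub>A\<^esub> b) = \<rho> a \<otimes>\<^bsub>GL n\<^esub> \<rho> b"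
      unfolding ab by (simp add: elt_mult RE smult_smult_mult[of _ n] RR smult_smult_times m mult_ac)
    show "\<beta> (a \<otimes>\<^bsub>A\<^esub> b) = \<rho> a \<otimes>\<^bsub>GL n\<^esub> \<beta> b \<otimes>\<^bsub>GL n\<^esub> inv\<^bsub>GL n\<^esub> (\<rho> a) \<otimes>\<^bsub>GL n\<^esub> \<beta> a"
      unfolding ab by (simp add: elt_mult BE RE inv_GL_smult smult_smult_mult[of _ n] GL_inv RB smult_smult_times m mult_ac)
  qed (use cl in auto)
  moreover have "PGL_class n (\<beta> a) = PGL_class n (\<beta>\<^sub>1 (\<pi> a)) \<and> PGL_class n (\<rho> a) = PGL_class n (\<rho>\<^sub>1 (\<pi> a))"
    if a: "a \<in> carrier A" for a
  proof -
    obtain k x where [simp]: "k \<in> carrier K" "x \<in> carrier Q" "a = elt k x" using elt_cases[OF a] .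
    have "\<phi> k / h x \<noteq> 0" by simp
    then show ?thesis using PGL_class_eq[OF cl(1)[OF a]] PGL_class_eq[OF cl(2)[OF a]] BE[of k x] RE[of k x]
      by (metis B R \<open>a = elt k x\<close> \<open>k \<in> carrier K\<close> \<open>x \<in> carrier Q\<close> \<pi>_elt)
  qed
  ultimately show ?thesis unfolding can_be_lifted_def by blast
qed

text \<open>The scalars relating the lift to \<open>\<beta>\<^sub>1\<close> fail to be
  multiplicative exactly by the multipliers, for both operations of A. Evaluation on \<iota> k + t x
  separates a character of K from a cobounding map.\<close>

lemma cohomologous_if_can_be_lifted:
  assumes n: "n \<ge> 1"
    and rep: "projective_brace_representation n Q \<alpha>\<^sub>1 \<mu>\<^sub>1 \<beta>\<^sub>1 \<rho>\<^sub>1"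
    and lift: "can_be_lifted n A \<pi> \<beta>\<^sub>1 \<rho>\<^sub>1"
  shows "\<exists>\<phi>\<in>hom K Cstar. \<exists>h. (\<forall>x\<in>carrier Q. h x \<noteq> 0) \<and> h \<zero>\<^bsub>Q\<^esub> = 1 \<and>
    (\<forall>x\<in>carrier Q. \<forall>y\<in>carrier Q. \<alpha>\<^sub>1 (x, y) = h x * h y / h (x \<oplus>\<^bsub>Q\<^esub> y) * \<phi> (\<alpha>t (x, y)) \<and>
      \<mu>\<^sub>1 (x, y) = h x * h y / h (x \<otimes>\<^bsub>Q\<^esub> y) * \<phi> (\<mu>t (x, y)))"
proof -
  have B [simp]: "\<beta>\<^sub>1 x \<in> carrier (GL n)" and R [simp]: "\<rho>\<^sub>1 x \<in> carrier (GL n)" if "x \<in> carrier Q" for x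
    using rep that by (auto simp: projective_brace_representation_def)
  have BB: "\<beta>\<^sub>1 x * \<beta>\<^sub>1 y = \<alpha>\<^sub>1 (x, y) \<cdot>\<^sub>m \<beta>\<^sub>1 (x \<oplus>\<^bsub>Q\<^esub> y)"
    and RB: "\<rho>\<^sub>1 x * \<beta>\<^sub>1 y * inv\<^bsub>GL n\<^esub> \<rho>\<^sub>1 x * \<beta>\<^sub>1 x = \<mu>\<^sub>1 (x, y) \<cdot>\<^sub>m \<beta>\<^sub>1 (x \<otimes>\<^bsub>Q\<^esub> y)"
    if "x \<in> carrier Q" "y \<in> carrier Q" for x y
    using rep that by (auto simp: projective_brace_representation_def)
  have B0 [simp]: "\<beta>\<^sub>1 \<zero>\<^bsub>Q\<^esub> = 1\<^sub>m n"
    using rep by (auto simp: projective_brace_representation_def)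
  obtain \<beta> \<rho> where br: "brace_representation n A \<beta> \<rho>"
    and cls: "\<And>a. a \<in> carrier A \<Longrightarrow> PGL_class n (\<beta> a) = PGL_class n (\<beta>\<^sub>1 (\<pi> a)) \<and>
                          PGL_class n (\<rho> a) = PGL_class n (\<rho>\<^sub>1 (\<pi> a))"
    using lift unfolding can_be_lifted_def by blast
  have bcl: "\<beta> a \<in> carrier (GL n)" "\<rho> a \<in> carrier (GL n)" if "a \<in> carrier A" for a
    using br that by (auto simp: brace_representation_def hom_def)
  have badd: "\<beta> (a \<oplus>\<^bsub>A\<^esub> b) = \<beta> a * \<beta> b"
    and bmix: "\<beta> (a \<otimes>\<^bsub>A\<^esub> b) = \<rho> a * \<beta> b * inv\<^bsub>GL n\<^esub> (\<rho> a) * \<beta> a" if "a \<in> carrier A" "b \<in> carrier A" for a b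
    using br that by (auto simp: brace_representation_def hom_def)
  have "\<forall>a\<in>carrier A. \<exists>c. c \<noteq> 0 \<and> \<beta> a = c \<cdot>\<^sub>m \<beta>\<^sub>1 (\<pi> a)"
    using PGL_class_eq[OF bcl(1) B[OF \<pi>_closed]] cls by auto
  then obtain c where c: "\<And>a. a \<in> carrier A \<Longrightarrow> c a \<noteq> 0" "\<And>a. a \<in> carrier A \<Longrightarrow> \<beta> a = c a \<cdot>\<^sub>m \<beta>\<^sub>1 (\<pi> a)"
    by metis
  have "\<forall>a\<in>carrier A. \<exists>d. d \<noteq> 0 \<and> \<rho> a = d \<cdot>\<^sub>m \<rho>\<^sub>1 (\<pi> a)"
    using PGL_class_eq[OF bcl(2) R[OF \<pi>_closed]] cls by auto
  then obtain d where d: "\<And>a. a \<in> carrier A \<Longrightarrow> d a \<noteq> 0" "\<And>a. a \<in> carrier A \<Longrightarrow> \<rho> a = d a \<cdot>\<^sub>m \<rho>\<^sub>1 (\<pi> a)"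
    by metis
  have cadd: "c (a \<oplus>\<^bsub>A\<^esub> b) = c a * c b * \<alpha>\<^sub>1 (\<pi> a, \<pi> b)" if [simp]: "a \<in> carrier A" "b \<in> carrier A" for a b
  proof -
    have "c (a \<oplus>\<^bsub>A\<^esub> b) \<cdot>\<^sub>m \<beta>\<^sub>1 (\<pi> a \<oplus>\<^bsub>Q\<^esub> \<pi> b) = (c a * c b * \<alpha>\<^sub>1 (\<pi> a, \<pi> b)) \<cdot>\<^sub>m \<beta>\<^sub>1 (\<pi> a \<oplus>\<^bsub>Q\<^esub> \<pi> b)"
      using badd[of a b] c(2)[of "a \<oplus>\<^bsub>A\<^esub> b"]
      by (simp add: c(2) \<pi>_add smult_smult_mult[of _ n] BB smult_smult_times)
    from GL_smult_cancel[OF B n this] show ?thesis by simp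
  qed
  \<comment> \<open>The scalar d a meets its inverse in the conjugation, so the mixed relation
    constrains c alone.\<close>
  have cmix: "c (a \<otimes>\<^bsub>A\<^esub> b) = c a * c b * \<mu>\<^sub>1 (\<pi> a, \<pi> b)" if [simp]: "a \<in> carrier A" "b \<in> carrier A" for a b
  proof -
    have "c (a \<otimes>\<^bsub>A\<^esub> b) \<cdot>\<^sub>m \<beta>\<^sub>1 (\<pi> a \<otimes>\<^bsub>Q\<^esub> \<pi> b) = (c a * c b * \<mu>\<^sub>1 (\<pi> a, \<pi> b)) \<cdot>\<^sub>m \<beta>\<^sub>1 (\<pi> a \<otimes>\<^bsub>Q\<^esub> \<pi> b)"
      using bmix[of a b] c(2)[of "a \<otimes>\<^bsub>A\<^esub> b"] d(1)[of a]
      by (simp add: c(2) d(2) \<pi>_circ smult_smult_mult[of _ n] RB smult_smult_times inv_GL_smult GL_inv mult_ac)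
    from GL_smult_cancel[OF B n this] show ?thesis by simp
  qed
  \<comment> \<open>The multiplier is 1 when its first argument is 0, as
    \<open>\<beta>\<^sub>1\<close> is the identity there. Hence c splits over \<iota> k + t x and is
    multiplicative on the image of \<iota>.\<close>
  have \<alpha>0: "\<alpha>\<^sub>1 (\<zero>\<^bsub>Q\<^esub>, x) = 1" if [simp]: "x \<in> carrier Q" for x
    using BB[of "\<zero>\<^bsub>Q\<^esub>" x] GL_smult_cancel[OF B[of x] n, of 1] by simp
  have c0: "c \<zero>\<^bsub>A\<^esub> = 1"
    using cadd[of "\<zero>\<^bsub>A\<^esub>" "\<zero>\<^bsub>A\<^esub>"] c(1)[of "\<zero>\<^bsub>A\<^esub>"] \<pi>_t[of "\<zero>\<^bsub>Q\<^esub>"] by (simp add: \<alpha>0)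
  have celt: "c (elt k x) = c (\<iota> k) * c (t x)" if "k \<in> carrier K" "x \<in> carrier Q" for k x
    using that cadd[of "\<iota> k" "t x"] by (simp add: elt_def \<alpha>0)
  show ?thesis
  \<comment> \<open>The cobounding map inverts c along t: computing c (t x + t y) by
    \<open>cadd\<close> and in coordinates isolates \<open>\<alpha>\<^sub>1\<close>, and
    \<open>cmix\<close> does the same for \<open>\<mu>\<^sub>1\<close>.\<close>
  proof (intro bexI[of _ "\<lambda>k. c (\<iota> k)"] exI[of _ "\<lambda>x. inverse (c (t x))"] conjI ballI)
    show "(\<lambda>k. c (\<iota> k)) \<in> hom K Cstar"
      using c(1) by (intro homI) (auto simp: \<iota>_mult cadd \<alpha>0)
    show "inverse (c (t \<zero>\<^bsub>Q\<^esub>)) = 1" by (simp add: c0)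
    show "inverse (c (t x)) \<noteq> 0" if "x \<in> carrier Q" for x using that c(1) by simp
    fix x y assume xy [simp]: "x \<in> carrier Q" "y \<in> carrier Q"
    have nz [simp]: "c (t z) \<noteq> 0" if "z \<in> carrier Q" for z using that c(1) by simp
    show "\<alpha>\<^sub>1 (x, y) = inverse (c (t x)) * inverse (c (t y)) / inverse (c (t (x \<oplus>\<^bsub>Q\<^esub> y))) * c (\<iota> (\<alpha>t (x, y)))"
      using cadd[of "t x" "t y"] by (simp add: t_add celt field_simps)
    show "\<mu>\<^sub>1 (x, y) = inverse (c (t x)) * inverse (c (t y)) / inverse (c (t (x \<otimes>\<^bsub>Q\<^esub> y))) * c (\<iota> (\<mu>t (x, y)))"
      using cmix[of "t x" "t y"] by (simp add: t_circ celt field_simps)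
  qed
qed

section \<open>Surjectivity of transgression and the lifting property\<close>

abbreviation "Trt \<equiv> transgression_via K \<iota> A Q t"

lemma carrier_schur_multiplier:
  "carrier (schur_multiplier Q)
    = {B2b Q Cstar #>\<^bsub>Z2b Q Cstar\<^esub> (\<alpha>, \<mu>) |\<alpha> \<mu>. factor_set Q Cstar \<alpha> \<mu>}"
  unfolding schur_multiplier_def H2b_def FactGroup_def RCOSETS_def by (auto simp: Z2b_def)

lemma transgression_in_schur_multiplier:
  "\<phi> \<in> hom K Cstar \<Longrightarrow> Trt \<phi> \<in> carrier (schur_multiplier Q)"
  unfolding carrier_schur_multiplier transgression_via_def using transgression_factor_set by blast

lemma lifting_property_if_surj:
  assumes surj: "carrier (schur_multiplier Q) \<subseteq> Trt ` hom K Cstar"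
  shows "lifting_property A \<pi> Q"
  unfolding lifting_property_def
proof (intro allI impI)
  fix n :: nat and \<alpha>\<^sub>1 \<mu>\<^sub>1 \<beta>\<^sub>1 \<rho>\<^sub>1
  assume *: "1 \<le> n" "\<alpha>\<^sub>1 \<in> carrier Q \<times> carrier Q \<rightarrow> carrier Cstar" "\<mu>\<^sub>1 \<in> carrier Q \<times> carrier Q \<rightarrow> carrier Cstar"
    and rep: "projective_brace_representation n Q \<alpha>\<^sub>1 \<mu>\<^sub>1 \<beta>\<^sub>1 \<rho>\<^sub>1"
  let ?QQ = "carrier Q \<times> carrier Q"
  \<comment> \<open>Factor sets are extensional, whereas the given multipliers are arbitrary off Q
    times Q; hence the restrictions.\<close>
  let ?z = "(restrict \<alpha>\<^sub>1 ?QQ, restrict \<mu>\<^sub>1 ?QQ)"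
  have "B2b Q Cstar #>\<^bsub>Z2b Q Cstar\<^esub> ?z \<in> carrier (schur_multiplier Q)"
    unfolding carrier_schur_multiplier
    using Q.projective_brace_representation_factor_set[OF * rep] by blast
  then obtain \<phi> where \<phi>: "\<phi> \<in> hom K Cstar" "B2b Q Cstar #>\<^bsub>Z2b Q Cstar\<^esub> ?z = Trt \<phi>"
    using surj by blast
  \<comment> \<open>A pair lies in its own coset, by the constant map 1, hence in the coset
    \<open>Trt\<close> \<phi>; membership there delivers h.\<close>
  have "?z \<in> B2b Q Cstar #>\<^bsub>Z2b Q Cstar\<^esub> ?z"
    unfolding B2b_coset_iff
    by (rule exI[of _ "\<lambda>_. 1"])
      (auto intro!: restrict_ext simp: Q.coboundary_add_Cstar Q.coboundary_circ_Cstar)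
  then obtain h where h: "\<forall>x\<in>carrier Q. h x \<noteq> 0"
    and eqs: "restrict \<alpha>\<^sub>1 ?QQ = (\<lambda>p\<in>?QQ. coboundary_add Q Cstar h p * (\<lambda>p\<in>?QQ. \<phi> (\<alpha>t p)) p)"
      "restrict \<mu>\<^sub>1 ?QQ = (\<lambda>p\<in>?QQ. coboundary_circ Q Cstar h p * (\<lambda>p\<in>?QQ. \<phi> (\<mu>t p)) p)"
    unfolding \<phi>(2) transgression_via_def B2b_coset_iff by blast
  show "can_be_lifted n A \<pi> \<beta>\<^sub>1 \<rho>\<^sub>1"
  proof (rule can_be_lifted_if_cohomologous[OF \<phi>(1) h _ _ rep])
    fix x y assume "x \<in> carrier Q" "y \<in> carrier Q"
    then show "\<alpha>\<^sub>1 (x, y) = h x * h y / h (x \<oplus>\<^bsub>Q\<^esub> y) * \<phi> (\<alpha>t (x, y))"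
      "\<mu>\<^sub>1 (x, y) = h x * h y / h (x \<otimes>\<^bsub>Q\<^esub> y) * \<phi> (\<mu>t (x, y))"
      using fun_cong[OF eqs(1), of "(x, y)"] fun_cong[OF eqs(2), of "(x, y)"]
      by (simp_all add: Q.coboundary_add_Cstar[OF h] Q.coboundary_circ_Cstar[OF h])
  qed
qed

text \<open>Finiteness of Q makes the twisted regular representation of a chosen factor set
  finite-dimensional, so it can be lifted; the character read off its lift is a preimage of the
  class.\<close>

lemma surj_if_lifting_property:
  assumes fin: "finite (carrier Q)" and lp: "lifting_property A \<pi> Q"
  shows "carrier (schur_multiplier Q) \<subseteq> Trt ` hom K Cstar"
proof
  fix V assume "V \<in> carrier (schur_multiplier Q)"
  then obtain \<alpha> \<mu> where V: "V = B2b Q Cstar #>\<^bsub>Z2b Q Cstar\<^esub> (\<alpha>, \<mu>)" and fs: "factor_set Q Cstar \<alpha> \<mu>"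
    unfolding carrier_schur_multiplier by blast
  obtain \<beta>\<^sub>1 \<rho>\<^sub>1 where rep: "projective_brace_representation (card (carrier Q)) Q \<alpha> \<mu> \<beta>\<^sub>1 \<rho>\<^sub>1"
    using Q.twisted_regular_representation[OF fin fs] by blast
  \<comment> \<open>The lifting property concerns degrees at least 1; Q contains 0.\<close>
  have n: "card (carrier Q) \<ge> 1"
    using fin Q.add.one_closed by (metis One_nat_def Suc_leI card_gt_0_iff empty_iff)
  have "\<alpha> \<in> carrier Q \<times> carrier Q \<rightarrow> carrier Cstar" "\<mu> \<in> carrier Q \<times> carrier Q \<rightarrow> carrier Cstar"
    using Q.factor_set_nonzero[OF fs] by auto
  then have "can_be_lifted (card (carrier Q)) A \<pi> \<beta>\<^sub>1 \<rho>\<^sub>1"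
    using lp n rep unfolding lifting_property_def by blast
  from cohomologous_if_can_be_lifted[OF n rep this]
  obtain \<phi> h where \<phi>: "\<phi> \<in> hom K Cstar" and h: "\<forall>x\<in>carrier Q. h x \<noteq> 0" "h \<zero>\<^bsub>Q\<^esub> = 1"
    and eqs: "\<forall>x\<in>carrier Q. \<forall>y\<in>carrier Q. \<alpha> (x, y) = h x * h y / h (x \<oplus>\<^bsub>Q\<^esub> y) * \<phi> (\<alpha>t (x, y)) \<and>
      \<mu> (x, y) = h x * h y / h (x \<otimes>\<^bsub>Q\<^esub> y) * \<phi> (\<mu>t (x, y))"
    by blast
  have "V = Trt \<phi>"
    unfolding V transgression_via_def by (rule Q.B2b_coset_eqI[OF h]) (use eqs in auto)
  then show "V \<in> Trt ` hom K Cstar" using \<phi> by blast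
qed

end

theorem theorem4p21:
  fixes K :: "'k monoid" and \<iota> :: "'k \<Rightarrow> 'a"
    and A :: "'a ring" and \<pi> :: "'a \<Rightarrow> 'q" and Q :: "'q ring"
  assumes "annihilator_extension K \<iota> A \<pi> Q"
    and "finite (carrier K)" and "finite (carrier A)" and "finite (carrier Q)"
  shows "Tra K \<iota> A \<pi> Q ` hom K Cstar = carrier (schur_multiplier Q)
    \<longleftrightarrow> lifting_property A \<pi> Q"
proof -
  interpret annihilator_extension K \<iota> A \<pi> Q by (rule assms(1))
  \<comment> \<open>The section chosen inside \<open>Tra\<close>. The results hold for every
    normalised section, so they apply to it.\<close>
  define t where "t = (SOME t. normalized_section A \<pi> Q t)"
  have "normalized_section A \<pi> Q t"
    unfolding t_def using normalized_section_exists by (rule someI_ex)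
  then interpret annihilator_extension_section K \<iota> A \<pi> Q t
    by unfold_locales
  have "Tra K \<iota> A \<pi> Q = Trt" by (simp add: Tra_def t_def)
  \<comment> \<open>Transgression always lands in the Schur multiplier, so surjectivity comes down
    to one inclusion.\<close>
  then show ?thesis
    using transgression_in_schur_multiplier lifting_property_if_surj surj_if_lifting_property[OF assms(4)]
    by auto
qed

end
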